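(* For a given $n$, let processes $X^n,Y^n,Z^n,\Psi^n$ satisfy the model equations (a)–(e) listed in the context, and let $\hat X^n,\hat Y^n,\hat Z^n,\hat\Psi^n$ be the corresponding diffusion-scaled processes. Then for all $t\ge 0$: $$\hat X^n(t)=\hat X^{0,n}+\hat W^n(t)+\int_0^t H^n\big(\hat X^n(s)-\hat Y^n(s),\hat N^n-\hat Z^n(s)\big)\,ds+\sum_{c\in\mathcal C}m_c^n\int_0^t\hat\Psi_c^n(s)\,ds,$$ $$\hat Y_i^n(t)\ge 0\ (i\in\mathcal I),\qquad \hat Z_j^n(t)\ge 0\ (j\in\mathcal J),\qquad \sum_{i\in\mathcal I}[\hat X_i^n(t)-\hat Y_i^n(t)]=\sum_{j\in\mathcal J}[\hat N_j^n-\hat Z_j^n(t)],$$ $$\hat\Psi_c^n(t)\ge 0,\qquad c\in\mathcal C.$$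
   Context: Parameters and fluid model. Let $I,J\ge 2$, $\mathcal I=\{1,\dots,I\}$ (customer classes), $\mathcal J=\{I+1,\dots,I+J\}$ (service stations). For each $n\in\mathbb N$ there are arrival rates $\lambda_i^n>0$, service rates $\mu_{ij}^n\ge 0$ and numbers of servers $N_j^n\in\mathbb N$ ($i\in\mathcal I,j\in\mathcal J$). The set $\mathcal E=\{(i,j):\mu_{ij}^n>0\}$ does not depend on $n$; write $i\sim j$ if $(i,j)\in\mathcal E$. Elements of $\mathcal E$ are called activities, and $\mathcal G$ is the graph with vertex set $\mathcal I\cup\mathcal J$ and edge set $\mathcal E$. There are constants $\lambda_i,\nu_j\in(0,\infty)$, $\mu_{ij}\in(0,\infty)$ for $(i,j)\in\mathcal E$, $\mu_{ij}=0$ for $(i,j)\notin\mathcal E$, and $\hat\lambda_i,\hat\mu_{ij}\in\mathbb R$ such that $n^{-1}\lambda_i^n\to\lambda_i$, $\mu_{ij}^n\to\mu_{ij}$, $n^{-1}N_j^n\to\nu_j$ and $$\hat\lambda_i^n:=n^{1/2}(n^{-1}\lambda_i^n-\lambda_i)\to\hat\lambda_i,\quad \hat\mu_{ij}^n:=n^{1/2}(\mu_{ij}^n-\mu_{ij})\to\hat\mu_{ij},\quad \hat N_j^n:=n^{1/2}(n^{-1}N_j^n-\nu_j)\to0 .$$ Let $\bar\mu_{ij}=\nu_j\mu_{ij}$ and consider the linear program: minimize $\rho\in\mathbb R_+$ subject to $\sum_{j}\bar\mu_{ij}\xi_{ij}=\lambda_i$, $\sum_i\xi_{ij}\le\rho$,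 $\xi_{ij}\ge0$ for all $i\in\mathcal I,j\in\mathcal J$. Standing assumption (heavy traffic): it has a unique optimal solution $(\xi^*,\rho^* )$, and $\sum_i\xi^*_{ij}=1$ for all $j\in\mathcal J$ (so $\rho^*=1$). Put $x_i^*=\sum_j\xi_{ij}^*\nu_j$, $\psi_{ij}^*=\xi_{ij}^*\nu_j$. An activity $(i,j)\in\mathcal E$ is basic if $\xi^*_{ij}>0$; $\mathcal E_b$ is the set of basic activities and $\mathcal E_{nb}=\mathcal E\setminus\mathcal E_b$. Standing assumption (complete resource pooling): the graph $\mathcal G_b$ with vertex set $\mathcal I\cup\mathcal J$ and edge set $\mathcal E_b$ is a tree. Simple cycles. $\mathcal C$ is the set of cycles that are subgraphs of $\mathcal G$ and have exactly one edge that is a nonbasic activity (called simple cycles). There is a one-to-one correspondence between $\mathcal E_{nb}$ and $\mathcal C$: $\sigma(i,j)$ is the simple cycle through $(i,j)\in\mathcal E_{nb}$. If $c\in\mathcal C$ has nonbasic edge $(i_0,j_0)$, orient $c$ cyclically so that this edge is directed from $i_0$ to $j_0$: $i_0\to j_0\to i_1\to j_1\to\cdots\to i_k\to j_k\to i_0$. For an edge $(i,j)$ of $c$ (written $(i,j)\in c$), $s(c,i,j)=-1$ if, in $c$, it is directed from $i$ to $j$, and $s(c,i,j)=1$ if it is directed from $j$ to $i$. Let $m_{i,c}^n=\sum_{j:(i,j)\in c}s(c,i,j)\mu_{ij}^n$ and $m_c^n=(m_{i,c}^n)_{i\in\mathcal I}$. The maps $G$, $H^n$. Let $D_G=\{(a,b)\in\mathbb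 R^I\times\mathbb R^J:\sum_ia_i=\sum_jb_j\}$. For $(a,b)\in D_G$ let $G(a,b)=(G_{ij}(a,b))$ be the unique $\psi$ with $\sum_j\psi_{ij}=a_i$ ($i\in\mathcal I$), $\sum_i\psi_{ij}=b_j$ ($j\in\mathcal J$), and $\psi_{ij}=0$ for $(i,j)\notin\mathcal E_b$. Put $H_i^n(a,b)=-\sum_j\mu_{ij}^nG_{ij}(a,b)$, $H^n=(H_i^n)_{i\in\mathcal I}$. Model equations. Primitive processes: with $\{\check U_i(k)\}_{k\in\mathbb N}$, $i\in\mathcal I$, independent sequences of strictly positive i.i.d. random variables with mean $1$ and finite variance, $A_i^n(t)=\sup\{l\ge0:\sum_{k=1}^l\check U_i(k)/\lambda_i^n\le t\}$; $S_{ij}^n$ are Poisson processes of rate $\mu_{ij}^n$ (the zero process if the rate is $0$), mutually independent and independent of the arrivals. Let $X_i^{0,n}\in\mathbb Z_+$ be deterministic initial conditions. $X_i^n$ (number of class-$i$ customers in the system), $Y_i^n$ (number of class-$i$ customers in queue), $Z_j^n$ (number of idle servers at station $j$), $\Psi_{ij}^n$ (number of class-$i$ customers in service at station $j$) satisfy for all $t\ge 0$, $i\in\mathcal I$, $j\in\mathcal J$: (a) $\Psi_{ij}^n(t)=0$ for $i\not\sim j$; (b) $X_i^n(t)=X_i^{0,n}+A_i^n(t)-\sum_{j}S_{ij}^n\big(\int_0^t\Psi_{ij}^n(s)ds\big)$; (c) $Y_i^n(t)+\sum_j\Psi_{ij}^n(t)=X_i^n(t)$; (d) $Z_j^n(t)+\sum_i\Psi_{ij}^n(t)=N_j^n$;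 (e) $Y_i^n(t)\ge0$, $Z_j^n(t)\ge0$, $\Psi_{ij}^n(t)\ge0$. Scaling. $\bar\Psi_{ij}^n=n^{-1}\Psi_{ij}^n$; $\hat A_i^n(t)=n^{-1/2}(A_i^n(t)-\lambda_i^nt)$; $\hat S_{ij}^n(t)=n^{-1/2}(S_{ij}^n(nt)-n\mu_{ij}^nt)$; $\hat X_i^n(t)=n^{-1/2}(X_i^n(t)-nx_i^* )$; $\hat X^{0,n}=\hat X^n(0)$; $\hat Y_i^n=n^{-1/2}Y_i^n$; $\hat Z_j^n=n^{-1/2}Z_j^n$; $\hat\Psi_{ij}^n(t)=n^{-1/2}(\Psi_{ij}^n(t)-\psi_{ij}^*n)$. With $\ell_i^n=\hat\lambda_i^n-\sum_j\hat\mu_{ij}^n\psi_{ij}^*$, $$\hat W_i^n(t)=\hat A_i^n(t)-\sum_{j\in\mathcal J}\hat S_{ij}^n\Big(\int_0^t\bar\Psi_{ij}^n(s)ds\Big)+\ell_i^nt .$$ For $c\in\mathcal C$ with $(i,j)=\sigma^{-1}(c)$, $\Psi_c^n=\Psi_{ij}^n$ and $\hat\Psi_c^n=n^{-1/2}\Psi_c^n$. Vectors without index denote the collections of components. *)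

theory Defs
  imports "HOL-Probability.Probability" "Graph_Theory.Graph_Theory"
begin

section \<open>Network data\<close>

text \<open>Sequences in the scaling parameter carry it as first argument and are only meant for
  \<open>n \<ge> 1\<close>. Rates with argument \<open>n\<close> are unscaled; \<open>lam\<close>, \<open>mu\<close>, \<open>nu\<close> are the fluid limits.\<close>

record network =
  num_classes  :: nat
  num_stations :: nat
  acts  :: "(nat \<times> nat) set"
  lam_n :: "nat \<Rightarrow> nat \<Rightarrow> real"
  mu_n  :: "nat \<Rightarrow> nat \<Rightarrow> nat \<Rightarrow> real"
  N_n   :: "nat \<Rightarrow> nat \<Rightarrow> nat"
  lam   :: "nat \<Rightarrow> real"
  mu    :: "nat \<Rightarrow> nat \<Rightarrow> real"
  nu    :: "nat \<Rightarrow> real"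
  lam_hat_lim :: "nat \<Rightarrow> real"
  mu_hat_lim  :: "nat \<Rightarrow> nat \<Rightarrow> real"
  xi_opt  :: "nat \<Rightarrow> nat \<Rightarrow> real"
  rho_opt :: real

definition classes :: "network \<Rightarrow> nat set" where
  "classes P = {1..num_classes P}"

definition stations :: "network \<Rightarrow> nat set" where
  "stations P = {num_classes P + 1..num_classes P + num_stations P}"

definition lam_hat :: "network \<Rightarrow> nat \<Rightarrow> nat \<Rightarrow> real" where
  "lam_hat P n i = sqrt (real n) * (lam_n P n i / real n - lam P i)"

definition mu_hat :: "network \<Rightarrow> nat \<Rightarrow> nat \<Rightarrow> nat \<Rightarrow> real" where
  "mu_hat P n i j = sqrt (real n) * (mu_n P n i j - mu P i j)"

definition N_hat :: "network \<Rightarrow> nat \<Rightarrow> nat \<Rightarrow> real" where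
  "N_hat P n j = sqrt (real n) * (real (N_n P n j) / real n - nu P j)"


section \<open>The static linear program\<close>

definition mu_bar :: "network \<Rightarrow> nat \<Rightarrow> nat \<Rightarrow> real" where
  "mu_bar P i j = nu P j * mu P i j"

definition lp_feasible :: "network \<Rightarrow> (nat \<Rightarrow> nat \<Rightarrow> real) \<Rightarrow> real \<Rightarrow> bool" where
  "lp_feasible P xi rho \<longleftrightarrow>
     0 \<le> rho \<and>
     (\<forall>i\<in>classes P. (\<Sum>j\<in>stations P. mu_bar P i j * xi i j) = lam P i) \<and>
     (\<forall>j\<in>stations P. (\<Sum>i\<in>classes P. xi i j) \<le> rho) \<and>
     (\<forall>i\<in>classes P. \<forall>j\<in>stations P. 0 \<le> xi i j)"

definition lp_optimal :: "network \<Rightarrow> (nat \<Rightarrow> nat \<Rightarrow> real) \<Rightarrow> real \<Rightarrow> bool" where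
  "lp_optimal P xi rho \<longleftrightarrow>
     lp_feasible P xi rho \<and> (\<forall>xi' rho'. lp_feasible P xi' rho' \<longrightarrow> rho \<le> rho')"

text \<open>Allocations are total functions on \<open>nat \<times> nat\<close>; only their restriction to
  classes and stations is meaningful, hence uniqueness is uniqueness there.\<close>

definition lp_unique_optimal :: "network \<Rightarrow> (nat \<Rightarrow> nat \<Rightarrow> real) \<Rightarrow> real \<Rightarrow> bool" where
  "lp_unique_optimal P xi rho \<longleftrightarrow>
     lp_optimal P xi rho \<and>
     (\<forall>xi' rho'. lp_optimal P xi' rho' \<longrightarrow>
        rho' = rho \<and> (\<forall>i\<in>classes P. \<forall>j\<in>stations P. xi' i j = xi i j))"

definition x_star :: "network \<Rightarrow> nat \<Rightarrow> real" where
  "x_star P i = (\<Sum>j\<in>stations P. xi_opt P i j * nu P j)"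

definition psi_star :: "network \<Rightarrow> nat \<Rightarrow> nat \<Rightarrow> real" where
  "psi_star P i j = xi_opt P i j * nu P j"

definition basic_acts :: "network \<Rightarrow> (nat \<times> nat) set" where
  "basic_acts P = {(i, j) \<in> acts P. xi_opt P i j > 0}"

definition nonbasic_acts :: "network \<Rightarrow> (nat \<times> nat) set" where
  "nonbasic_acts P = acts P - basic_acts P"


section \<open>Activity graphs\<close>

text \<open>Undirected graphs are represented as symmetric digraphs. The library predicate
  \<open>tree\<close> forbids every directed cycle, so it would reject each edge of a symmetric digraph
  (as a cycle of length 2) and would not see undirected cycles if edges were directed from classes
  to stations. Undirected cycles are therefore directed cycles of length at least 3 in
  the symmetric digraph; such an arc list is a cycle together with an orientation.\<close>

definition act_graph :: "network \<Rightarrow> (nat \<times> nat) set \<Rightarrow> nat pair_pre_digraph" where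
  "act_graph P E = \<lparr> pverts = classes P \<union> stations P, parcs = E \<union> E\<inverse> \<rparr>"

definition undirected_cycle :: "nat pair_pre_digraph \<Rightarrow> (nat \<times> nat) list \<Rightarrow> bool" where
  "undirected_cycle G p \<longleftrightarrow> pre_digraph.cycle (with_proj G) p \<and> 3 \<le> length p"

definition undirected_tree :: "nat pair_pre_digraph \<Rightarrow> bool" where
  "undirected_tree G \<longleftrightarrow>
     Digraph_Component.connected (with_proj G) \<and> \<not> (\<exists>p. undirected_cycle G p)"


section \<open>Standing assumptions\<close>

locale heavy_traffic_network =
  fixes P :: network
  assumes two_classes: "2 \<le> num_classes P"
    and two_stations: "2 \<le> num_stations P"
    and lam_n_pos: "\<And>n i. 1 \<le> n \<Longrightarrow> i \<in> classes P \<Longrightarrow> 0 < lam_n P n i"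
    and mu_n_nonneg: "\<And>n i j. 1 \<le> n \<Longrightarrow> i \<in> classes P \<Longrightarrow> j \<in> stations P \<Longrightarrow> 0 \<le> mu_n P n i j"
    and N_n_pos: "\<And>n j. 1 \<le> n \<Longrightarrow> j \<in> stations P \<Longrightarrow> 0 < N_n P n j"
    and acts_eq: "\<And>n. 1 \<le> n \<Longrightarrow> acts P = {(i, j) \<in> classes P \<times> stations P. 0 < mu_n P n i j}"
    and lam_pos: "\<And>i. i \<in> classes P \<Longrightarrow> 0 < lam P i"
    and nu_pos: "\<And>j. j \<in> stations P \<Longrightarrow> 0 < nu P j"
    and mu_pos: "\<And>i j. (i, j) \<in> acts P \<Longrightarrow> 0 < mu P i j"
    and mu_zero: "\<And>i j. i \<in> classes P \<Longrightarrow> j \<in> stations P \<Longrightarrow> (i, j) \<notin> acts P \<Longrightarrow> mu P i j = 0"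
    and lam_lim: "\<And>i. i \<in> classes P \<Longrightarrow> (\<lambda>n. lam_n P n i / real n) \<longlonglongrightarrow> lam P i"
    and mu_lim: "\<And>i j. i \<in> classes P \<Longrightarrow> j \<in> stations P \<Longrightarrow> (\<lambda>n. mu_n P n i j) \<longlonglongrightarrow> mu P i j"
    and N_lim: "\<And>j. j \<in> stations P \<Longrightarrow> (\<lambda>n. real (N_n P n j) / real n) \<longlonglongrightarrow> nu P j"
    and lam_hat_lim: "\<And>i. i \<in> classes P \<Longrightarrow> (\<lambda>n. lam_hat P n i) \<longlonglongrightarrow> lam_hat_lim P i"
    and mu_hat_lim: "\<And>i j. i \<in> classes P \<Longrightarrow> j \<in> stations P \<Longrightarrow>
          (\<lambda>n. mu_hat P n i j) \<longlonglongrightarrow> mu_hat_lim P i j"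
    and N_hat_lim: "\<And>j. j \<in> stations P \<Longrightarrow> (\<lambda>n. N_hat P n j) \<longlonglongrightarrow> 0"
    and lp_unique: "lp_unique_optimal P (xi_opt P) (rho_opt P)"
    and critical_load: "\<And>j. j \<in> stations P \<Longrightarrow> (\<Sum>i\<in>classes P. xi_opt P i j) = 1"
    and resource_pooling: "undirected_tree (act_graph P (basic_acts P))"


section \<open>Simple cycles\<close>

text \<open>A cycle, as a subgraph, has no isolated vertices, so it is identified with its edge set,
  a set of activities.\<close>

definition cycle_edges :: "network \<Rightarrow> (nat \<times> nat) list \<Rightarrow> (nat \<times> nat) set" where
  "cycle_edges P p = {(i, j) \<in> acts P. (i, j) \<in> set p \<or> (j, i) \<in> set p}"

definition simple_cycles :: "network \<Rightarrow> (nat \<times> nat) set set" where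
  "simple_cycles P =
     {c. (\<exists>p. undirected_cycle (act_graph P (acts P)) p \<and> c = cycle_edges P p) \<and>
         card (c \<inter> nonbasic_acts P) = 1}"

definition sigma_cycle :: "network \<Rightarrow> nat \<times> nat \<Rightarrow> (nat \<times> nat) set" where
  "sigma_cycle P e = (THE c. c \<in> simple_cycles P \<and> e \<in> c)"

definition sigma_inv :: "network \<Rightarrow> (nat \<times> nat) set \<Rightarrow> nat \<times> nat" where
  "sigma_inv P = inv_into (nonbasic_acts P) (sigma_cycle P)"

text \<open>The arcs of \<open>c\<close> in the cyclic orientation that directs its nonbasic edge from class to
  station.\<close>

definition orientation :: "network \<Rightarrow> (nat \<times> nat) set \<Rightarrow> (nat \<times> nat) set" where
  "orientation P c =
     (THE D. \<exists>p. undirected_cycle (act_graph P (acts P)) p \<and> cycle_edges P p = c \<and>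
                 D = set p \<and> D \<inter> nonbasic_acts P \<noteq> {})"

definition cycle_sign :: "network \<Rightarrow> (nat \<times> nat) set \<Rightarrow> nat \<Rightarrow> nat \<Rightarrow> real" where
  "cycle_sign P c i j =
     (if (i, j) \<in> orientation P c then - 1 else if (j, i) \<in> orientation P c then 1 else 0)"

definition m_cycle :: "network \<Rightarrow> nat \<Rightarrow> (nat \<times> nat) set \<Rightarrow> nat \<Rightarrow> real" where
  "m_cycle P n c i = (\<Sum>j\<in>{j \<in> stations P. (i, j) \<in> c}. cycle_sign P c i j * mu_n P n i j)"


section \<open>The maps G and H\<close>

text \<open>The matrix vanishes at all index pairs outside the basic activities, including
  those outside classes and stations; this makes it unique as a total function. The value of
  \<open>G_map\<close> is meaningful only if the entries of \<open>a\<close> and \<open>b\<close> have equal sums.\<close>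

definition G_map :: "network \<Rightarrow> (nat \<Rightarrow> real) \<Rightarrow> (nat \<Rightarrow> real) \<Rightarrow> nat \<Rightarrow> nat \<Rightarrow> real" where
  "G_map P a b =
     (THE psi. (\<forall>i\<in>classes P. (\<Sum>j\<in>stations P. psi i j) = a i) \<and>
               (\<forall>j\<in>stations P. (\<Sum>i\<in>classes P. psi i j) = b j) \<and>
               (\<forall>i j. (i, j) \<notin> basic_acts P \<longrightarrow> psi i j = 0))"

definition H_map :: "network \<Rightarrow> nat \<Rightarrow> (nat \<Rightarrow> real) \<Rightarrow> (nat \<Rightarrow> real) \<Rightarrow> nat \<Rightarrow> real" where
  "H_map P n a b i = - (\<Sum>j\<in>stations P. mu_n P n i j * G_map P a b i j)"


section \<open>Primitive processes\<close>

definition poisson_process :: "'w measure \<Rightarrow> real \<Rightarrow> (real \<Rightarrow> 'w \<Rightarrow> nat) \<Rightarrow> bool" where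
  "poisson_process M r S \<longleftrightarrow>
     (\<forall>t\<ge>0. S t \<in> measurable M (count_space UNIV)) \<and>
     (\<forall>\<omega>\<in>space M. S 0 \<omega> = 0 \<and> mono_on {0..} (\<lambda>t. S t \<omega>) \<and>
        (\<forall>t\<ge>0. continuous (at_right t) (\<lambda>t. S t \<omega>))) \<and>
     (\<forall>s t. 0 \<le> s \<longrightarrow> s < t \<longrightarrow>
        distr M (count_space UNIV) (\<lambda>\<omega>. S t \<omega> - S s \<omega>) = measure_pmf (poisson_pmf (r * (t - s)))) \<and>
     (\<forall>\<tau> m. 0 \<le> \<tau> (0::nat) \<longrightarrow> mono \<tau> \<longrightarrow>
        prob_space.indep_vars M (\<lambda>_. count_space UNIV) (\<lambda>l \<omega>. S (\<tau> (Suc l)) \<omega> - S (\<tau> l) \<omega>) {..<m::nat})"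

text \<open>The events determined by the family \<open>X t\<close>, \<open>t \<in> T\<close>, of \<open>N\<close>-valued random variables.\<close>

definition generated_events :: "'w measure \<Rightarrow> 't set \<Rightarrow> 'b measure \<Rightarrow> ('t \<Rightarrow> 'w \<Rightarrow> 'b) \<Rightarrow> 'w set set" where
  "generated_events M T N X =
     sets (vimage_algebra (space M) (\<lambda>\<omega>. \<lambda>t\<in>T. X t \<omega>) (\<Pi>\<^sub>M t\<in>T. N))"

text \<open>\<open>U i k\<close>, \<open>k \<ge> 1\<close>, are the unit-mean interarrival variables of class \<open>i\<close>; \<open>S i j\<close> is the
  service process of activity \<open>(i, j)\<close> in the \<open>n\<close>-th system.\<close>

locale primitive_processes = prob_space M for M :: "'w measure" +
  fixes P :: network and n :: nat
    and U :: "nat \<Rightarrow> nat \<Rightarrow> 'w \<Rightarrow> real"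
    and S :: "nat \<Rightarrow> nat \<Rightarrow> real \<Rightarrow> 'w \<Rightarrow> nat"
  assumes U_pos: "\<And>i k \<omega>. i \<in> classes P \<Longrightarrow> 1 \<le> k \<Longrightarrow> \<omega> \<in> space M \<Longrightarrow> 0 < U i k \<omega>"
    and U_indep: "\<And>i. i \<in> classes P \<Longrightarrow> indep_vars (\<lambda>_. borel) (U i) {1..}"
    and U_ident: "\<And>i k. i \<in> classes P \<Longrightarrow> 1 \<le> k \<Longrightarrow> distr M borel (U i k) = distr M borel (U i 1)"
    and U_integrable: "\<And>i k. i \<in> classes P \<Longrightarrow> 1 \<le> k \<Longrightarrow> integrable M (U i k)"
    and U_mean: "\<And>i k. i \<in> classes P \<Longrightarrow> 1 \<le> k \<Longrightarrow> expectation (U i k) = 1"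
    and U_variance: "\<And>i k. i \<in> classes P \<Longrightarrow> 1 \<le> k \<Longrightarrow> integrable M (\<lambda>\<omega>. (U i k \<omega>)\<^sup>2)"
    and S_poisson: "\<And>i j. i \<in> classes P \<Longrightarrow> j \<in> stations P \<Longrightarrow> 0 < mu_n P n i j \<Longrightarrow>
          poisson_process M (mu_n P n i j) (S i j)"
    and S_zero: "\<And>i j t \<omega>. i \<in> classes P \<Longrightarrow> j \<in> stations P \<Longrightarrow> mu_n P n i j = 0 \<Longrightarrow>
          0 \<le> t \<Longrightarrow> \<omega> \<in> space M \<Longrightarrow> S i j t \<omega> = 0"
    and mutually_indep:
      "indep_sets
         (\<lambda>x. case x of
                Inl i \<Rightarrow> generated_events M {1..} borel (U i)
              | Inr (i, j) \<Rightarrow> generated_events M {0..} (count_space UNIV) (S i j))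
         (classes P <+> classes P \<times> stations P)"

text \<open>For \<open>t \<ge> 0\<close> the set contains 0. It is unbounded only on a null event, where \<open>Sup\<close> on
  \<open>nat\<close> returns a conventional value.\<close>

definition arrivals :: "network \<Rightarrow> nat \<Rightarrow> (nat \<Rightarrow> nat \<Rightarrow> 'w \<Rightarrow> real) \<Rightarrow> nat \<Rightarrow> real \<Rightarrow> 'w \<Rightarrow> nat" where
  "arrivals P n U i t \<omega> = Sup {l. (\<Sum>k=1..l. U i k \<omega> / lam_n P n i) \<le> t}"


section \<open>Model equations\<close>

definition counting_processes ::
  "'w measure \<Rightarrow> network \<Rightarrow> (nat \<Rightarrow> real \<Rightarrow> 'w \<Rightarrow> int) \<Rightarrow> (nat \<Rightarrow> real \<Rightarrow> 'w \<Rightarrow> int) \<Rightarrow>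
   (nat \<Rightarrow> real \<Rightarrow> 'w \<Rightarrow> int) \<Rightarrow> (nat \<Rightarrow> nat \<Rightarrow> real \<Rightarrow> 'w \<Rightarrow> int) \<Rightarrow> bool" where
  "counting_processes M P X Y Z Psi \<longleftrightarrow>
     (\<forall>t\<ge>0. \<forall>i\<in>classes P. \<forall>j\<in>stations P.
        X i t \<in> measurable M (count_space UNIV) \<and> Y i t \<in> measurable M (count_space UNIV) \<and>
        Z j t \<in> measurable M (count_space UNIV) \<and> Psi i j t \<in> measurable M (count_space UNIV))"

text \<open>The equations along the sample path \<open>\<omega>\<close>. The first conjunct makes the time integrals
  meaningful: the paths of \<open>Psi\<close> are Borel (e.g. right-continuous with left limits), and they are
  bounded by the last three equations.\<close>

definition model_equations ::
  "network \<Rightarrow> nat \<Rightarrow> (nat \<Rightarrow> nat \<Rightarrow> 'w \<Rightarrow> real) \<Rightarrow> (nat \<Rightarrow> nat \<Rightarrow> real \<Rightarrow> 'w \<Rightarrow> nat) \<Rightarrow> (nat \<Rightarrow> nat) \<Rightarrow>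
   (nat \<Rightarrow> real \<Rightarrow> 'w \<Rightarrow> int) \<Rightarrow> (nat \<Rightarrow> real \<Rightarrow> 'w \<Rightarrow> int) \<Rightarrow>
   (nat \<Rightarrow> real \<Rightarrow> 'w \<Rightarrow> int) \<Rightarrow> (nat \<Rightarrow> nat \<Rightarrow> real \<Rightarrow> 'w \<Rightarrow> int) \<Rightarrow> 'w \<Rightarrow> bool" where
  "model_equations P n U S X0 X Y Z Psi \<omega> \<longleftrightarrow>
     (\<forall>i\<in>classes P. \<forall>j\<in>stations P.
        set_borel_measurable lborel {0..} (\<lambda>s. real_of_int (Psi i j s \<omega>))) \<and>
     (\<forall>t\<ge>0. \<forall>i\<in>classes P. \<forall>j\<in>stations P.
        ((i, j) \<notin> acts P \<longrightarrow> Psi i j t \<omega> = 0) \<and>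
        X i t \<omega> = int (X0 i) + int (arrivals P n U i t \<omega>)
          - (\<Sum>j'\<in>stations P. int (S i j' (LINT s:{0..t}|lborel. real_of_int (Psi i j' s \<omega>)) \<omega>)) \<and>
        Y i t \<omega> + (\<Sum>j'\<in>stations P. Psi i j' t \<omega>) = X i t \<omega> \<and>
        Z j t \<omega> + (\<Sum>i'\<in>classes P. Psi i' j t \<omega>) = int (N_n P n j) \<and>
        0 \<le> Y i t \<omega> \<and> 0 \<le> Z j t \<omega> \<and> 0 \<le> Psi i j t \<omega>)"


section \<open>Diffusion scaling\<close>

definition Psi_bar :: "nat \<Rightarrow> (nat \<Rightarrow> nat \<Rightarrow> real \<Rightarrow> 'w \<Rightarrow> int) \<Rightarrow> nat \<Rightarrow> nat \<Rightarrow> real \<Rightarrow> 'w \<Rightarrow> real" where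
  "Psi_bar n Psi i j t \<omega> = real_of_int (Psi i j t \<omega>) / real n"

definition A_hat :: "network \<Rightarrow> nat \<Rightarrow> (nat \<Rightarrow> nat \<Rightarrow> 'w \<Rightarrow> real) \<Rightarrow> nat \<Rightarrow> real \<Rightarrow> 'w \<Rightarrow> real" where
  "A_hat P n U i t \<omega> = (real (arrivals P n U i t \<omega>) - lam_n P n i * t) / sqrt (real n)"

definition S_hat :: "network \<Rightarrow> nat \<Rightarrow> (nat \<Rightarrow> nat \<Rightarrow> real \<Rightarrow> 'w \<Rightarrow> nat) \<Rightarrow> nat \<Rightarrow> nat \<Rightarrow> real \<Rightarrow> 'w \<Rightarrow> real" where
  "S_hat P n S i j t \<omega> = (real (S i j (real n * t) \<omega>) - real n * mu_n P n i j * t) / sqrt (real n)"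

definition X_hat :: "network \<Rightarrow> nat \<Rightarrow> (nat \<Rightarrow> real \<Rightarrow> 'w \<Rightarrow> int) \<Rightarrow> nat \<Rightarrow> real \<Rightarrow> 'w \<Rightarrow> real" where
  "X_hat P n X i t \<omega> = (real_of_int (X i t \<omega>) - real n * x_star P i) / sqrt (real n)"

definition Y_hat :: "nat \<Rightarrow> (nat \<Rightarrow> real \<Rightarrow> 'w \<Rightarrow> int) \<Rightarrow> nat \<Rightarrow> real \<Rightarrow> 'w \<Rightarrow> real" where
  "Y_hat n Y i t \<omega> = real_of_int (Y i t \<omega>) / sqrt (real n)"

definition Z_hat :: "nat \<Rightarrow> (nat \<Rightarrow> real \<Rightarrow> 'w \<Rightarrow> int) \<Rightarrow> nat \<Rightarrow> real \<Rightarrow> 'w \<Rightarrow> real" where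
  "Z_hat n Z j t \<omega> = real_of_int (Z j t \<omega>) / sqrt (real n)"

definition ell :: "network \<Rightarrow> nat \<Rightarrow> nat \<Rightarrow> real" where
  "ell P n i = lam_hat P n i - (\<Sum>j\<in>stations P. mu_hat P n i j * psi_star P i j)"

definition W_hat ::
  "network \<Rightarrow> nat \<Rightarrow> (nat \<Rightarrow> nat \<Rightarrow> 'w \<Rightarrow> real) \<Rightarrow> (nat \<Rightarrow> nat \<Rightarrow> real \<Rightarrow> 'w \<Rightarrow> nat) \<Rightarrow>
   (nat \<Rightarrow> nat \<Rightarrow> real \<Rightarrow> 'w \<Rightarrow> int) \<Rightarrow> nat \<Rightarrow> real \<Rightarrow> 'w \<Rightarrow> real" where
  "W_hat P n U S Psi i t \<omega> =
     A_hat P n U i t \<omega>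
     - (\<Sum>j\<in>stations P. S_hat P n S i j (LINT s:{0..t}|lborel. Psi_bar n Psi i j s \<omega>) \<omega>)
     + ell P n i * t"

text \<open>\<open>n\<^sup>-\<^sup>1\<^sup>/\<^sup>2 \<Psi>\<^sub>c\<close>, without centering.\<close>

definition Psi_cycle_hat ::
  "network \<Rightarrow> nat \<Rightarrow> (nat \<Rightarrow> nat \<Rightarrow> real \<Rightarrow> 'w \<Rightarrow> int) \<Rightarrow> (nat \<times> nat) set \<Rightarrow> real \<Rightarrow> 'w \<Rightarrow> real" where
  "Psi_cycle_hat P n Psi c t \<omega> =
     (case sigma_inv P c of (i, j) \<Rightarrow> real_of_int (Psi i j t \<omega>)) / sqrt (real n)"

end

theory Submission
  imports Defs
begin

text \<open>Everything is algebra along one sample path. Substituting the definitions of the scaled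
  processes into the balance equation for the number of class \<open>i\<close> customers, the arrival and service
  fluctuations form \<open>W_hat\<close> together with \<open>ell\<close>; the order \<open>sqrt n\<close> drifts cancel because the optimal
  allocation serves exactly the arrival rates, \<open>lam i = (\<Sum>j. mu i j * psi_star i j)\<close>. What is left is the
  integral of \<open>- (\<Sum>j. mu_n i j * Psi_hat i j)\<close>, where \<open>Psi_hat\<close> is the centred and scaled occupancy.

  So the point is to express \<open>Psi_hat\<close> through its row sums \<open>X_hat - Y_hat\<close>, its column sums
  \<open>N_hat - Z_hat\<close>, and its nonbasic entries (lemma \<open>H_map_eq\<close>). Sending one unit around a simple cycle
  changes no row or column sum, and it changes only one nonbasic entry. Adding for each simple cycle
  \<open>c\<close> the array \<open>cycle_sign c\<close> times the entry of \<open>Psi_hat\<close> at the nonbasic activity of \<open>c\<close> cancels all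
  nonbasic entries. The result is supported on the basic activities and has the same row
  and column sums, hence it is the value of \<open>G_map\<close>. Multiplying by the service rates gives
  \<open>H_map\<close> and the vectors \<open>m_cycle\<close>.

  The graph theory rests on one fact, \<open>balanced_on_forest_eq_0\<close>: an array with zero row and column
  sums that is supported on a forest vanishes, since otherwise its support has no vertex of
  degree one and contains a cycle. It makes \<open>G_map\<close> well defined. Applied to the
  difference of two circulations, it also shows that a nonbasic activity lies on just one simple
  cycle and that this cycle has just one orientation through the activity, so all definite
  descriptions in the definitions denote what they should.\<close>

section \<open>Circulations along closed walks\<close>

text \<open>The circulation pushing one unit along \<open>p\<close>, as an antisymmetric array. The sign is that of
  \<open>cycle_sign\<close>: at \<open>(x, y)\<close> it is negative when the arc leaves \<open>x\<close>.\<close>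

definition circ :: "('a \<times> 'a) list \<Rightarrow> 'a \<Rightarrow> 'a \<Rightarrow> real" where
  "circ p x y = of_bool ((y, x) \<in> set p) - of_bool ((x, y) \<in> set p)"

lemma circ_antisym: "circ p y x = - circ p x y"
  by (simp add: circ_def)

lemma pcas_append: "pcas u (p @ q) w \<longleftrightarrow> (\<exists>v. pcas u p v \<and> pcas v q w)"
  by (induction p arbitrary: u) auto

lemma pcas_pawalk_verts: "pcas u p v \<Longrightarrow> pawalk_verts u p = u # map snd p"
  by (induction p arbitrary: u) auto

lemma pcas_divergence:
  "pcas u p v \<Longrightarrow>
     (\<Sum>a\<leftarrow>p. of_bool (snd a = x) - of_bool (fst a = x)) = (of_bool (v = x) - of_bool (u = x) :: real)"
  by (induction p arbitrary: u) auto

text \<open>For a closed walk, the distinctness of vertices demanded by \<open>cycle\<close> is distinctness of the arc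
  heads. This form avoids lists of vertices.\<close>

lemma undirected_cycle_iff:
  "undirected_cycle G p \<longleftrightarrow>
     (\<exists>u\<in>pverts G. pcas u p u) \<and> set p \<subseteq> parcs G \<and> distinct (map snd p) \<and> 3 \<le> length p"
proof -
  have "(\<exists>u. u \<in> pverts G \<and> set p \<subseteq> parcs G \<and> pcas u p u \<and> distinct (tl (pawalk_verts u p))) \<longleftrightarrow>
        (\<exists>u\<in>pverts G. pcas u p u) \<and> set p \<subseteq> parcs G \<and> distinct (map snd p)"
    by (auto simp: pcas_pawalk_verts)
  then show ?thesis
    unfolding undirected_cycle_def pre_digraph.cycle_def pre_digraph.awalk_def
      cas_with_proj_eq awalk_verts_with_proj_eq with_proj_simps
    by (cases p) auto
qed

lemma undirected_cycle_distinct: "undirected_cycle G p \<Longrightarrow> distinct p"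
  unfolding undirected_cycle_iff by (simp add: distinct_map)

text \<open>This is where cycles of length 2 must be excluded. If both \<open>(x, y)\<close> and \<open>(y, x)\<close> occur, cut
  the cycle at \<open>(x, y)\<close>: the rest is a walk from \<open>y\<close> to \<open>x\<close>. Its last arc enters \<open>x\<close>, so it is \<open>(y, x)\<close>,
  and nothing can precede it because \<open>y\<close> has already been entered.\<close>

lemma undirected_cycle_no_reverse_arc:
  assumes p: "undirected_cycle G p" and xy: "(x, y) \<in> set p"
  shows "(y, x) \<notin> set p"
proof
  assume yx: "(y, x) \<in> set p"
  obtain u where walk: "pcas u p u" and dist: "distinct (map snd p)" and len: "3 \<le> length p"
    using p unfolding undirected_cycle_iff by blast
  obtain q r where split: "p = q @ (x, y) # r"
    using xy by (meson split_list)
  have ret: "pcas y (r @ q) x"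
    using walk unfolding split by (auto simp: pcas_append)
  have "x \<noteq> y"
  proof
    assume "x = y"
    have "r @ q \<noteq> []" using len split by auto
    then obtain s a where "r @ q = s @ [a]" by (metis rev_exhaust)
    with ret \<open>x = y\<close> have "snd a = y" "a \<in> set (r @ q)" by (auto simp: pcas_append)
    with dist show False unfolding split by (auto simp: image_iff)
  qed
  then have mem: "(y, x) \<in> set (r @ q)" using yx split by auto
  then obtain s a where s: "r @ q = s @ [a]" by (metis rev_exhaust empty_iff list.set(1))
  have dist': "distinct (map snd (r @ q))" "y \<notin> snd ` set (r @ q)"
    using dist unfolding split by auto
  have "snd a = x" using ret unfolding s by (auto simp: pcas_append)
  with mem dist'(1) have a: "a = (y, x)"
    unfolding s by (auto simp: image_iff)
  have "pcas y s y" using ret unfolding s a by (auto simp: pcas_append)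
  then have "s = []"
  proof (cases s rule: rev_cases)
    case (snoc s' b)
    with \<open>pcas y s y\<close> have "snd b = y" by (auto simp: pcas_append)
    with snoc s dist'(2) show ?thesis by auto
  qed simp
  then have "length (r @ q) = 1" using s by simp
  then show False using len split by simp
qed

text \<open>Counts the arcs into \<open>x\<close> by their tails, which turns sums over neighbours into sums over the
  arcs of a walk.\<close>

lemma sum_of_bool_fibre:
  assumes "finite A" "finite J" "\<And>a. a \<in> A \<Longrightarrow> snd a = x \<Longrightarrow> fst a \<in> J"
  shows "(\<Sum>y\<in>J. of_bool ((y, x) \<in> A)) = (\<Sum>a\<in>A. of_bool (snd a = x) :: real)"
proof -
  have "{a \<in> A. snd a = x} = (\<lambda>y. (y, x)) ` {y \<in> J. (y, x) \<in> A}"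
    using assms(3) by force
  then have "card {a \<in> A. snd a = x} = card {y \<in> J. (y, x) \<in> A}"
    by (simp add: card_image inj_on_def)
  moreover have "J \<inter> {y. (y, x) \<in> A} = {y \<in> J. (y, x) \<in> A}" "A \<inter> {a. snd a = x} = {a \<in> A. snd a = x}"
    by auto
  ultimately show ?thesis using assms(1,2)
    by (simp add: of_bool_def sum.If_cases)
qed

text \<open>A closed walk enters each vertex as often as it leaves it.\<close>

lemma circ_balanced:
  assumes p: "undirected_cycle G p" and fin: "finite J"
    and nbr: "\<And>y. (x, y) \<in> parcs G \<or> (y, x) \<in> parcs G \<Longrightarrow> y \<in> J"
  shows "(\<Sum>y\<in>J. circ p x y) = 0"
proof -
  obtain u where walk: "pcas u p u" and sub: "set p \<subseteq> parcs G"
    using p unfolding undirected_cycle_iff by blast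
  have into: "(\<Sum>y\<in>J. of_bool ((y, x) \<in> set p)) = (\<Sum>a\<in>set p. of_bool (snd a = x) :: real)"
    using nbr sub fin by (intro sum_of_bool_fibre) auto
  have "(\<Sum>y\<in>J. of_bool ((y, x) \<in> prod.swap ` set p)) =
          (\<Sum>a\<in>prod.swap ` set p. of_bool (snd a = x) :: real)"
    using nbr sub fin by (intro sum_of_bool_fibre) auto
  also have "\<dots> = (\<Sum>a\<in>set p. of_bool (fst a = x))"
    by (subst sum.reindex) (auto simp: inj_on_def)
  finally have out: "(\<Sum>y\<in>J. of_bool ((x, y) \<in> set p)) = (\<Sum>a\<in>set p. of_bool (fst a = x) :: real)"
    by (simp add: image_iff prod.swap_def Bex_def)
  have "(\<Sum>y\<in>J. circ p x y) = (\<Sum>a\<in>set p. of_bool (snd a = x) - of_bool (fst a = x))"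
    by (simp add: circ_def sum_subtractf into out)
  also have "\<dots> = (\<Sum>a\<leftarrow>p. of_bool (snd a = x) - of_bool (fst a = x))"
    using undirected_cycle_distinct[OF p] by (simp add: sum_list_distinct_conv_sum_set)
  also have "\<dots> = 0" using pcas_divergence[OF walk, of x] by simp
  finally show ?thesis .
qed


section \<open>Balanced functions on forests\<close>

text \<open>Follow arcs of \<open>D\<close> forever without turning back. By finiteness some vertex is revisited, and
  the stretch up to the first return is a cycle; it has length at least 3 since there are neither
  loops nor immediate returns.\<close>

lemma undirected_cycle_if_no_dead_end:
  assumes fin: "finite D" and sub: "D \<subseteq> parcs G" and verts: "fst ` D \<subseteq> pverts G"
    and loopfree: "\<And>x. (x, x) \<notin> D"
    and ne: "D \<noteq> {}"
    and continue: "\<And>x y. (x, y) \<in> D \<Longrightarrow> \<exists>z. z \<noteq> x \<and> (y, z) \<in> D"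
  shows "\<exists>p. undirected_cycle G p"
proof -
  obtain a where "a \<in> D" using ne by blast
  define nxt where "nxt e = (snd e, SOME z. z \<noteq> fst e \<and> (snd e, z) \<in> D)" for e
  define g where "g = (\<lambda>k::nat. (nxt ^^ k) a)"
  define f where "f k = fst (g k)" for k
  have nxt: "nxt e \<in> D \<and> fst (nxt e) = snd e \<and> snd (nxt e) \<noteq> fst e" if "e \<in> D" for e
    using someI_ex[OF continue, of "fst e" "snd e"] that unfolding nxt_def by auto
  have g: "g k \<in> D" for k
    by (induction k) (auto simp: g_def \<open>a \<in> D\<close> nxt)
  have gS: "g (Suc k) = nxt (g k)" for k by (simp add: g_def)
  have g_eq: "g k = (f k, f (Suc k))" for k
    using nxt[OF g[of k]] by (simp add: f_def gS prod_eq_iff)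
  have arc: "(f k, f (Suc k)) \<in> D" for k using g[of k] by (simp add: g_eq)
  have step: "f (Suc k) \<noteq> f k" for k using arc[of k] loopfree by metis
  have turn: "f (Suc (Suc k)) \<noteq> f k" for k
    using nxt[OF g[of k]] by (simp add: f_def gS[symmetric]) (simp add: g_eq)
  have "\<not> inj f"
  proof
    assume "inj f"
    moreover have "range f \<subseteq> fst ` D" using arc by force
    ultimately show False using fin finite_imageD finite_subset by blast
  qed
  then have ex: "\<exists>m. \<exists>k<m. f k = f m"
    unfolding inj_def by (metis linorder_neqE_nat)
  \<comment> \<open>\<open>m\<close> is the time of the first return, so no vertex repeats strictly before it.\<close>
  define m where "m = (LEAST m. \<exists>k<m. f k = f m)"
  obtain k where k: "k < m" "f k = f m" using LeastI_ex[OF ex] unfolding m_def by blast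
  have least: "f l \<noteq> f l'" if "l < l'" "l' < m" for l l'
    using not_less_Least[of l'] that unfolding m_def by blast
  have "m \<noteq> Suc k" using k step by metis
  moreover have "m \<noteq> Suc (Suc k)" using k turn by metis
  ultimately have len: "k + 3 \<le> m" using k(1) by linarith
  define p where "p = map (\<lambda>l. (f l, f (Suc l))) [k..<m]"
  have walk: "pcas (f k) (map (\<lambda>l. (f l, f (Suc l))) [k..<l]) (f l)" if "k \<le> l" for l
    using that by (induction l rule: dec_induct) (auto simp: pcas_append)
  have inj: "inj_on (\<lambda>l. f (Suc l)) {k..<m}"
  proof (rule linorder_inj_onI)
    fix l l' assume l: "l < l'" "l \<in> {k..<m}" "l' \<in> {k..<m}"
    show "f (Suc l) \<noteq> f (Suc l')"
    proof (cases "Suc l' = m")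
      case True
      then show ?thesis using least[of k "Suc l"] k l by auto
    next
      case False
      then show ?thesis using least[of "Suc l" "Suc l'"] l by auto
    qed
  qed auto
  have "undirected_cycle G p"
    unfolding undirected_cycle_iff
  proof (intro conjI)
    show "\<exists>u\<in>pverts G. pcas u p u"
      using walk[of m] k arc[of k] verts unfolding p_def by force
    show "set p \<subseteq> parcs G" using arc sub by (auto simp: p_def)
    show "distinct (map snd p)" using inj by (simp add: p_def distinct_map comp_def)
    show "3 \<le> length p" using len by (simp add: p_def)
  qed
  then show ?thesis by blast
qed

lemma finite_classes [simp]: "finite (classes P)" and finite_stations [simp]: "finite (stations P)"
  by (simp_all add: classes_def stations_def)

lemma classes_stations_disjoint: "i \<in> classes P \<Longrightarrow> i \<in> stations P \<Longrightarrow> False"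
  by (auto simp: classes_def stations_def)

lemma sum_eq_0_other_nonzero:
  assumes "finite A" "(\<Sum>x\<in>A. f x) = (0::real)" "a \<in> A" "f a \<noteq> 0"
  shows "\<exists>b\<in>A. b \<noteq> a \<and> f b \<noteq> 0"
proof (rule ccontr)
  assume "\<not> ?thesis"
  then have "(\<Sum>x\<in>A - {a}. f x) = 0" by (intro sum.neutral) auto
  with assms sum.remove[of A a f] show False by simp
qed

text \<open>An edge at which \<open>d\<close> is nonzero shares each of its endpoints with another such edge, because
  the entries at that vertex cancel. So a nonzero \<open>d\<close> would force a cycle in its support.\<close>

lemma balanced_on_forest_eq_0:
  assumes acyclic: "\<nexists>p. undirected_cycle (act_graph P E) p"
    and rows: "\<And>i. i \<in> classes P \<Longrightarrow> (\<Sum>j\<in>stations P. d i j) = (0::real)"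
    and cols: "\<And>j. j \<in> stations P \<Longrightarrow> (\<Sum>i\<in>classes P. d i j) = 0"
    and supp: "\<And>i j. i \<in> classes P \<Longrightarrow> j \<in> stations P \<Longrightarrow> (i, j) \<notin> E \<Longrightarrow> d i j = 0"
    and ij: "i \<in> classes P" "j \<in> stations P"
  shows "d i j = 0"
proof (rule ccontr)
  assume nz: "d i j \<noteq> 0"
  define B where "B = {(i, j) \<in> classes P \<times> stations P. d i j \<noteq> 0}"
  have BE: "B \<subseteq> E" using supp by (auto simp: B_def)
  have Bsub: "B \<subseteq> classes P \<times> stations P" by (auto simp: B_def)
  have "\<exists>p. undirected_cycle (act_graph P E) p"
  proof (rule undirected_cycle_if_no_dead_end[where D = "B \<union> B\<inverse>"])
    show "finite (B \<union> B\<inverse>)"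
      using finite_subset[OF Bsub] by auto
    show "B \<union> B\<inverse> \<subseteq> parcs (act_graph P E)" using BE by (auto simp: act_graph_def)
    show "fst ` (B \<union> B\<inverse>) \<subseteq> pverts (act_graph P E)" using Bsub by (auto simp: act_graph_def)
    show "(x, x) \<notin> B \<union> B\<inverse>" for x using Bsub classes_stations_disjoint by blast
    show "B \<union> B\<inverse> \<noteq> {}" using nz ij by (auto simp: B_def)
    show "\<exists>z. z \<noteq> x \<and> (y, z) \<in> B \<union> B\<inverse>" if "(x, y) \<in> B \<union> B\<inverse>" for x y
    proof (cases "(x, y) \<in> B")
      case True
      then show ?thesis
        using sum_eq_0_other_nonzero[OF finite_classes cols[of y], of x] by (auto simp: B_def)
    next
      case False
      with that have "(y, x) \<in> B" by auto
      then show ?thesis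
        using sum_eq_0_other_nonzero[OF finite_stations rows[of y], of x] by (auto simp: B_def)
    qed
  qed
  with acyclic show False by blast
qed

section \<open>Basic activities\<close>

context heavy_traffic_network
begin

lemma acts_subset: "acts P \<subseteq> classes P \<times> stations P"
  using acts_eq[of 1] by auto

lemma basic_subset: "basic_acts P \<subseteq> acts P"
  by (auto simp: basic_acts_def)

lemma acts_reverse: "(x, y) \<in> acts P \<Longrightarrow> (y, x) \<notin> acts P"
  using acts_subset classes_stations_disjoint by blast

lemma basic_acyclic: "\<nexists>p. undirected_cycle (act_graph P (basic_acts P)) p"
  using resource_pooling by (simp add: undirected_tree_def)

lemma lp_feasible_xi_opt: "lp_feasible P (xi_opt P) (rho_opt P)"
  using lp_unique by (simp add: lp_unique_optimal_def lp_optimal_def)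

text \<open>At a pair with service rate zero an allocation costs capacity and serves nobody. Dropping it keeps
  the allocation optimal, so uniqueness of the optimum forbids it.\<close>

lemma xi_opt_zero_off_acts:
  assumes ij: "i \<in> classes P" "j \<in> stations P" "(i, j) \<notin> acts P"
  shows "xi_opt P i j = 0"
proof -
  define xi where "xi k l = (if (k, l) \<in> acts P then xi_opt P k l else 0)" for k l
  note feas = lp_feasible_xi_opt[unfolded lp_feasible_def]
  have "lp_feasible P xi (rho_opt P)"
    unfolding lp_feasible_def
  proof (intro conjI ballI)
    show "0 \<le> rho_opt P" using feas by blast
    show "(\<Sum>l\<in>stations P. mu_bar P k l * xi k l) = lam P k" if "k \<in> classes P" for k
    proof -
      have "(\<Sum>l\<in>stations P. mu_bar P k l * xi k l) = (\<Sum>l\<in>stations P. mu_bar P k l * xi_opt P k l)"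
        using that by (intro sum.cong) (auto simp: xi_def mu_bar_def mu_zero)
      then show ?thesis using feas that by simp
    qed
    show "(\<Sum>k\<in>classes P. xi k l) \<le> rho_opt P" if "l \<in> stations P" for l
    proof -
      have "(\<Sum>k\<in>classes P. xi k l) \<le> (\<Sum>k\<in>classes P. xi_opt P k l)"
        using that feas by (intro sum_mono) (auto simp: xi_def)
      then show ?thesis using feas that by force
    qed
    show "0 \<le> xi k l" if "k \<in> classes P" "l \<in> stations P" for k l
      using that feas by (auto simp: xi_def)
  qed
  then have "lp_optimal P xi (rho_opt P)"
    using lp_unique by (simp add: lp_unique_optimal_def lp_optimal_def)
  then have "xi i j = xi_opt P i j"
    using lp_unique ij by (simp add: lp_unique_optimal_def)
  then show ?thesis using ij by (simp add: xi_def)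
qed

lemma psi_star_zero_off_basic:
  assumes "i \<in> classes P" "j \<in> stations P" "(i, j) \<notin> basic_acts P"
  shows "psi_star P i j = 0"
proof -
  have "0 \<le> xi_opt P i j" using lp_feasible_xi_opt assms by (simp add: lp_feasible_def)
  then have "xi_opt P i j = 0"
    using assms xi_opt_zero_off_acts[of i j] by (cases "(i, j) \<in> acts P") (auto simp: basic_acts_def)
  then show ?thesis by (simp add: psi_star_def)
qed

lemma sum_psi_star_station: "j \<in> stations P \<Longrightarrow> (\<Sum>i\<in>classes P. psi_star P i j) = nu P j"
  by (simp add: psi_star_def sum_distrib_right[symmetric] critical_load)

lemma lam_eq: "i \<in> classes P \<Longrightarrow> lam P i = (\<Sum>j\<in>stations P. mu P i j * psi_star P i j)"
  using lp_feasible_xi_opt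
  by (simp add: lp_feasible_def psi_star_def mu_bar_def mult_ac)

text \<open>To evaluate \<open>G_map\<close> it suffices to exhibit an array with the right sums that vanishes at the
  nonbasic pairs of a class and a station. Values outside classes and stations are cut off by \<open>h\<close>.\<close>

lemma G_map_eq:
  assumes rows: "\<And>i. i \<in> classes P \<Longrightarrow> (\<Sum>j\<in>stations P. g i j) = a i"
    and cols: "\<And>j. j \<in> stations P \<Longrightarrow> (\<Sum>i\<in>classes P. g i j) = b j"
    and supp: "\<And>i j. i \<in> classes P \<Longrightarrow> j \<in> stations P \<Longrightarrow> (i, j) \<notin> basic_acts P \<Longrightarrow> g i j = 0"
    and ij: "i \<in> classes P" "j \<in> stations P"
  shows "G_map P a b i j = g i j"
proof -
  define h where "h i j = (if (i, j) \<in> basic_acts P then g i j else 0)" for i j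
  have h: "h i j = g i j" if "i \<in> classes P" "j \<in> stations P" for i j
    using that supp by (auto simp: h_def)
  have hrows: "(\<Sum>j\<in>stations P. h i j) = a i" if "i \<in> classes P" for i
    using that h rows[of i] by simp
  have hcols: "(\<Sum>i\<in>classes P. h i j) = b j" if "j \<in> stations P" for j
    using that h cols[of j] by simp
  have "G_map P a b = h"
    unfolding G_map_def
  proof (rule the_equality, intro conjI ballI allI impI)
    show "(\<Sum>j\<in>stations P. h i j) = a i" if "i \<in> classes P" for i by (rule hrows[OF that])
    show "(\<Sum>i\<in>classes P. h i j) = b j" if "j \<in> stations P" for j by (rule hcols[OF that])
    show "h i j = 0" if "(i, j) \<notin> basic_acts P" for i j using that by (simp add: h_def)
  next
    fix psi
    assume psi: "(\<forall>i\<in>classes P. (\<Sum>j\<in>stations P. psi i j) = a i) \<and>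
      (\<forall>j\<in>stations P. (\<Sum>i\<in>classes P. psi i j) = b j) \<and>
      (\<forall>i j. (i, j) \<notin> basic_acts P \<longrightarrow> psi i j = 0)"
    show "psi = h"
    proof (intro ext)
      fix k l
      show "psi k l = h k l"
      proof (cases "(k, l) \<in> basic_acts P")
        case True
        then have kl: "k \<in> classes P" "l \<in> stations P" using basic_subset acts_subset by auto
        have "psi k l - h k l = 0"
        proof (rule balanced_on_forest_eq_0[OF basic_acyclic, where d = "\<lambda>i j. psi i j - h i j", OF _ _ _ kl])
          show "(\<Sum>j\<in>stations P. psi i j - h i j) = 0" if "i \<in> classes P" for i
            using psi that by (simp add: sum_subtractf hrows)
          show "(\<Sum>i\<in>classes P. psi i j - h i j) = 0" if "j \<in> stations P" for j
            using psi that by (simp add: sum_subtractf hcols)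
          show "psi i j - h i j = 0" if "(i, j) \<notin> basic_acts P" for i j
            using psi that by (simp add: h_def)
        qed
        then show ?thesis by simp
      next
        case False
        then show ?thesis using psi by (simp add: h_def)
      qed
    qed
  qed
  then show ?thesis using h ij by simp
qed


section \<open>Simple cycles\<close>

text \<open>Passes from arcs to edges: of the two arcs between a class and a station only the one leaving the
  class is an activity.\<close>

lemma arc_iff_cycle_edge:
  assumes "undirected_cycle (act_graph P (acts P)) p" "i \<in> classes P" "j \<in> stations P"
  shows "(i, j) \<in> set p \<or> (j, i) \<in> set p \<longleftrightarrow> (i, j) \<in> cycle_edges P p"
proof -
  have "set p \<subseteq> acts P \<union> (acts P)\<inverse>"
    using assms(1) by (auto simp: undirected_cycle_iff act_graph_def)
  moreover have "(j, i) \<notin> acts P"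
    using assms(2,3) acts_subset classes_stations_disjoint by blast
  ultimately show ?thesis by (auto simp: cycle_edges_def)
qed

lemma circ_off_cycle:
  assumes "undirected_cycle (act_graph P (acts P)) p" "i \<in> classes P" "j \<in> stations P"
    "(i, j) \<notin> cycle_edges P p"
  shows "circ p i j = 0"
  using arc_iff_cycle_edge[OF assms(1-3)] assms(4) by (auto simp: circ_def)

lemma circ_rows:
  assumes "undirected_cycle (act_graph P (acts P)) p" "i \<in> classes P"
  shows "(\<Sum>j\<in>stations P. circ p i j) = 0"
  using assms acts_subset classes_stations_disjoint
  by (intro circ_balanced[OF assms(1)]) (auto simp: act_graph_def)

lemma circ_cols:
  assumes "undirected_cycle (act_graph P (acts P)) p" "j \<in> stations P"
  shows "(\<Sum>i\<in>classes P. circ p i j) = 0"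
proof -
  have "(\<Sum>i\<in>classes P. circ p j i) = 0"
    using assms acts_subset classes_stations_disjoint
    by (intro circ_balanced[OF assms(1)]) (auto simp: act_graph_def)
  then show ?thesis by (simp add: circ_antisym[of p j] sum_negf)
qed

text \<open>The circulation determines the arcs of the cycle, so uniqueness of cycles becomes uniqueness of
  circulations.\<close>

lemma cycle_arc_iff:
  assumes "undirected_cycle (act_graph P (acts P)) p"
  shows "(x, y) \<in> set p \<longleftrightarrow>
    (x \<in> classes P \<and> y \<in> stations P \<and> circ p x y = - 1 \<or> y \<in> classes P \<and> x \<in> stations P \<and> circ p y x = 1)"
proof -
  have "set p \<subseteq> acts P \<union> (acts P)\<inverse>"
    using assms by (auto simp: undirected_cycle_iff act_graph_def)
  then have "(x, y) \<in> set p \<Longrightarrow> x \<in> classes P \<and> y \<in> stations P \<or> y \<in> classes P \<and> x \<in> stations P"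
    using acts_subset by auto
  then show ?thesis
    using undirected_cycle_no_reverse_arc[OF assms]
    by (auto simp: circ_def of_bool_def split: if_splits)
qed

text \<open>If \<open>(i0, j0)\<close> is the only nonbasic edge of both cycles and the circulations are matched there, their
  difference is balanced and lives on the basic tree, hence vanishes.\<close>

lemma circ_proportional:
  assumes p: "undirected_cycle (act_graph P (acts P)) p" "cycle_edges P p \<inter> nonbasic_acts P \<subseteq> {(i0, j0)}"
    and q: "undirected_cycle (act_graph P (acts P)) q" "cycle_edges P q \<inter> nonbasic_acts P \<subseteq> {(i0, j0)}"
    and e: "circ p i0 j0 = s * circ q i0 j0"
    and ij: "i \<in> classes P" "j \<in> stations P"
  shows "circ p i j = s * circ q i j"
proof -
  have "circ p i j - s * circ q i j = 0"
  proof (rule balanced_on_forest_eq_0[OF basic_acyclic, where d = "\<lambda>i j. circ p i j - s * circ q i j", OF _ _ _ ij])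
    show "(\<Sum>j\<in>stations P. circ p i j - s * circ q i j) = 0" if "i \<in> classes P" for i
      using that by (simp add: sum_subtractf sum_distrib_left[symmetric] circ_rows p q)
    show "(\<Sum>i\<in>classes P. circ p i j - s * circ q i j) = 0" if "j \<in> stations P" for j
      using that by (simp add: sum_subtractf sum_distrib_left[symmetric] circ_cols p q)
    show "circ p i j - s * circ q i j = 0"
      if "i \<in> classes P" "j \<in> stations P" "(i, j) \<notin> basic_acts P" for i j
    proof (cases "(i, j) = (i0, j0)")
      case True
      then show ?thesis using e by simp
    next
      case False
      with that p(2) q(2) have "(i, j) \<notin> cycle_edges P p" "(i, j) \<notin> cycle_edges P q"
        by (auto simp: nonbasic_acts_def cycle_edges_def)
      then show ?thesis using that by (simp add: circ_off_cycle p q)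
    qed
  qed
  then show ?thesis by simp
qed

lemma oriented_cycle_unique:
  assumes p: "undirected_cycle (act_graph P (acts P)) p" "cycle_edges P p \<inter> nonbasic_acts P \<subseteq> {(i0, j0)}"
    and q: "undirected_cycle (act_graph P (acts P)) q" "cycle_edges P q \<inter> nonbasic_acts P \<subseteq> {(i0, j0)}"
    and e: "(i0, j0) \<in> set p" "(i0, j0) \<in> set q"
  shows "set p = set q"
proof -
  have "circ p i0 j0 = 1 * circ q i0 j0"
    using e p q undirected_cycle_no_reverse_arc by (auto simp: circ_def)
  note circ_proportional[OF p q this]
  then show ?thesis using cycle_arc_iff[OF p(1)] cycle_arc_iff[OF q(1)] by auto
qed

text \<open>The two cycles may traverse \<open>e\<close> in opposite directions. Comparing the circulations up to the
  sign \<open>s\<close> covers this without reversing a cycle.\<close>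

lemma cycle_edges_unique:
  assumes p: "undirected_cycle (act_graph P (acts P)) p" "cycle_edges P p \<inter> nonbasic_acts P = {e}"
    and q: "undirected_cycle (act_graph P (acts P)) q" "cycle_edges P q \<inter> nonbasic_acts P = {e}"
  shows "cycle_edges P p = cycle_edges P q"
proof -
  obtain i0 j0 where e: "e = (i0, j0)" by (cases e)
  have in_both: "(i0, j0) \<in> cycle_edges P p" "(i0, j0) \<in> cycle_edges P q" using p q e by auto
  have pm: "circ r i0 j0 = 1 \<or> circ r i0 j0 = - 1"
    if "undirected_cycle (act_graph P (acts P)) r" "(i0, j0) \<in> cycle_edges P r" for r
    using that undirected_cycle_no_reverse_arc by (auto simp: circ_def cycle_edges_def)
  define s where "s = circ p i0 j0 * circ q i0 j0"
  have s: "s \<noteq> 0" "circ p i0 j0 = s * circ q i0 j0"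
    using pm[OF p(1) in_both(1)] pm[OF q(1) in_both(2)] by (auto simp: s_def)
  have scaled: "circ p i j = s * circ q i j" if "i \<in> classes P" "j \<in> stations P" for i j
    using circ_proportional[of p i0 j0 q s] p q e s that by simp
  have edge: "(i, j) \<in> cycle_edges P r \<longleftrightarrow> (i, j) \<in> acts P \<and> circ r i j \<noteq> 0"
    if "undirected_cycle (act_graph P (acts P)) r" for r i j
    using that undirected_cycle_no_reverse_arc by (auto simp: circ_def cycle_edges_def)
  have "(i, j) \<in> cycle_edges P p \<longleftrightarrow> (i, j) \<in> cycle_edges P q" for i j
    unfolding edge[OF p(1)] edge[OF q(1)] using scaled s acts_subset by auto
  then show ?thesis by auto
qed

lemma basic_path:
  assumes "x \<in> classes P \<union> stations P" "y \<in> classes P \<union> stations P"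
  shows "\<exists>q. set q \<subseteq> basic_acts P \<union> (basic_acts P)\<inverse> \<and> pcas x q y \<and> distinct (x # map snd q)"
proof -
  let ?G = "mk_symmetric (with_proj (act_graph P (basic_acts P)))"
  interpret S: pair_wf_digraph ?G
    using basic_subset acts_subset
    by unfold_locales (auto simp: act_graph_def parcs_mk_symmetric)
  have "strongly_connected ?G"
    using resource_pooling by (simp add: undirected_tree_def connected_def)
  then have "x \<rightarrow>\<^sup>*\<^bsub>?G\<^esub> y"
    using assms by (auto simp: strongly_connected_def act_graph_def)
  then obtain q where "S.apath x q y" using S.reachable_apath by blast
  then have q: "set q \<subseteq> parcs ?G" "pcas x q y" "distinct (pawalk_verts x q)"
    by (auto simp: S.apath_def S.awalk_def)
  have "parcs ?G = basic_acts P \<union> (basic_acts P)\<inverse>"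
    by (auto simp: parcs_mk_symmetric act_graph_def)
  with q show ?thesis by (auto simp: pcas_pawalk_verts intro!: exI[of _ q])
qed

text \<open>Close up the path of basic activities from \<open>j0\<close> to \<open>i0\<close> with the nonbasic arc. The path has at
  least two arcs because its ends are distinct and are not joined by a basic activity.\<close>

lemma simple_cycle_exists:
  assumes e: "(i0, j0) \<in> nonbasic_acts P"
  shows "\<exists>p. undirected_cycle (act_graph P (acts P)) p \<and> (i0, j0) \<in> set p \<and>
             cycle_edges P p \<inter> nonbasic_acts P = {(i0, j0)}"
proof -
  have e': "(i0, j0) \<in> acts P" "(i0, j0) \<notin> basic_acts P" using e by (auto simp: nonbasic_acts_def)
  then have V: "i0 \<in> classes P" "j0 \<in> stations P" using acts_subset by auto
  obtain q where q: "set q \<subseteq> basic_acts P \<union> (basic_acts P)\<inverse>" "pcas j0 q i0" "distinct (j0 # map snd q)"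
    using basic_path[of j0 i0] V by blast
  have neq: "i0 \<noteq> j0" using V classes_stations_disjoint by blast
  have notin: "(j0, i0) \<notin> acts P" using e'(1) acts_reverse by blast
  have len: "2 \<le> length q"
  proof (rule ccontr)
    assume "\<not> 2 \<le> length q"
    then consider "q = []" | a where "q = [a]"
      by (cases q; cases "tl q") auto
    then show False
      using q neq e' notin basic_subset by cases auto
  qed
  define p where "p = (i0, j0) # q"
  have cyc: "undirected_cycle (act_graph P (acts P)) p"
    unfolding undirected_cycle_iff using q len basic_subset e' V
    by (auto simp: p_def act_graph_def intro!: bexI[of _ i0])
  have basic_edges: "b \<in> basic_acts P" if "b \<in> acts P" "b \<in> set q \<or> prod.swap b \<in> set q" for b
  proof -
    have "prod.swap b \<notin> basic_acts P"
      using that(1) basic_subset acts_reverse by (cases b) auto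
    then show ?thesis using that q(1) by (cases b) auto
  qed
  have "cycle_edges P p \<inter> nonbasic_acts P = {(i0, j0)}"
    using e e' notin basic_edges by (auto simp: cycle_edges_def p_def nonbasic_acts_def)
  with cyc show ?thesis by (auto simp: p_def)
qed

text \<open>The representative \<open>p\<close> is taken oriented so that the nonbasic edge points from class to station,
  as \<open>orientation\<close> requires.\<close>

lemma simple_cycleE:
  assumes "c \<in> simple_cycles P"
  obtains i0 j0 p where "(i0, j0) \<in> nonbasic_acts P" "undirected_cycle (act_graph P (acts P)) p"
    "(i0, j0) \<in> set p" "cycle_edges P p = c" "c \<inter> nonbasic_acts P = {(i0, j0)}"
proof -
  obtain q e where q: "undirected_cycle (act_graph P (acts P)) q" "c = cycle_edges P q"
    "c \<inter> nonbasic_acts P = {e}"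
    using assms by (auto simp: simple_cycles_def card_1_singleton_iff)
  obtain i0 j0 where e: "e = (i0, j0)" by (cases e)
  have nb: "(i0, j0) \<in> nonbasic_acts P" using q e by auto
  obtain p where p: "undirected_cycle (act_graph P (acts P)) p" "(i0, j0) \<in> set p"
      "cycle_edges P p \<inter> nonbasic_acts P = {(i0, j0)}"
    using simple_cycle_exists[OF nb] by blast
  have "cycle_edges P p = c" using cycle_edges_unique[OF p(1,3) q(1)] q e by simp
  then show thesis using that[OF nb p(1,2)] q e by blast
qed

lemma simple_cycle_through_unique:
  assumes "e \<in> nonbasic_acts P"
  shows "\<exists>!c. c \<in> simple_cycles P \<and> e \<in> c"
proof -
  obtain i0 j0 where e: "e = (i0, j0)" by (cases e)
  obtain p where p: "undirected_cycle (act_graph P (acts P)) p" "cycle_edges P p \<inter> nonbasic_acts P = {e}"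
    using simple_cycle_exists assms e by blast
  show ?thesis
  proof (rule ex1I[of _ "cycle_edges P p"])
    show "cycle_edges P p \<in> simple_cycles P \<and> e \<in> cycle_edges P p"
      using p by (auto simp: simple_cycles_def)
    fix c assume c: "c \<in> simple_cycles P \<and> e \<in> c"
    then obtain q f where q: "undirected_cycle (act_graph P (acts P)) q" "cycle_edges P q = c"
      "c \<inter> nonbasic_acts P = {f}"
      by (metis simple_cycleE)
    with c assms have q_e: "cycle_edges P q \<inter> nonbasic_acts P = {e}" by auto
    show "c = cycle_edges P p" using cycle_edges_unique[OF q(1) q_e p] q by simp
  qed
qed

lemma sigma_cycle_eq:
  assumes "c \<in> simple_cycles P" "e \<in> c" "e \<in> nonbasic_acts P"
  shows "sigma_cycle P e = c"
  unfolding sigma_cycle_def using simple_cycle_through_unique[OF assms(3)] assms by (intro the1_equality) auto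

text \<open>Since \<open>sigma_cycle\<close> is onto the simple cycles, its inverse picks the nonbasic edge of \<open>c\<close>.\<close>

lemma sigma_inv_eq:
  assumes c: "c \<in> simple_cycles P"
  shows "c \<inter> nonbasic_acts P = {sigma_inv P c}"
proof -
  obtain e where e: "c \<inter> nonbasic_acts P = {e}" using simple_cycleE[OF c] by metis
  then have "sigma_cycle P e = c" using sigma_cycle_eq[OF c] by blast
  then have img: "c \<in> sigma_cycle P ` nonbasic_acts P" using e by blast
  have inv: "sigma_inv P c \<in> nonbasic_acts P" "sigma_cycle P (sigma_inv P c) = c"
    unfolding sigma_inv_def using inv_into_into[OF img] f_inv_into_f[OF img] by simp_all
  have "sigma_inv P c \<in> sigma_cycle P (sigma_inv P c)"
    using simple_cycle_through_unique[OF inv(1)] sigma_cycle_eq[OF _ _ inv(1)] by metis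
  with inv e show ?thesis by auto
qed

lemma finite_simple_cycles: "finite (simple_cycles P)"
proof (rule finite_subset)
  show "simple_cycles P \<subseteq> Pow (acts P)" by (auto simp: simple_cycles_def cycle_edges_def)
  show "finite (Pow (acts P))" using finite_subset[OF acts_subset] by simp
qed

text \<open>All oriented representatives of \<open>c\<close> share one arc set, so \<open>orientation\<close> is that set and
  \<open>cycle_sign\<close> is the circulation along any of them.\<close>

lemma cycle_sign_eq_circ:
  assumes c: "c \<in> simple_cycles P"
  obtains p where "undirected_cycle (act_graph P (acts P)) p" "cycle_edges P p = c"
    "sigma_inv P c \<in> set p" "\<And>i j. cycle_sign P c i j = circ p i j"
proof -
  obtain i0 j0 p where p: "(i0, j0) \<in> nonbasic_acts P" "undirected_cycle (act_graph P (acts P)) p"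
    "(i0, j0) \<in> set p" "cycle_edges P p = c" "c \<inter> nonbasic_acts P = {(i0, j0)}"
    by (rule simple_cycleE[OF c])
  have "orientation P c = set p"
    unfolding orientation_def
  proof (rule the_equality)
    show "\<exists>q. undirected_cycle (act_graph P (acts P)) q \<and> cycle_edges P q = c \<and>
      set p = set q \<and> set p \<inter> nonbasic_acts P \<noteq> {}"
      using p by blast
    fix D assume "\<exists>q. undirected_cycle (act_graph P (acts P)) q \<and> cycle_edges P q = c \<and>
      D = set q \<and> D \<inter> nonbasic_acts P \<noteq> {}"
    then obtain q e where q: "undirected_cycle (act_graph P (acts P)) q" "cycle_edges P q = c"
      "D = set q" "e \<in> set q" "e \<in> nonbasic_acts P" by blast
    then have "e \<in> c" by (cases e) (auto simp: cycle_edges_def nonbasic_acts_def)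
    then have "e = (i0, j0)" using p q by blast
    then show "D = set p" using oriented_cycle_unique[OF q(1) _ p(2)] p q by simp
  qed
  then have "cycle_sign P c i j = circ p i j" for i j
    using undirected_cycle_no_reverse_arc[OF p(2)] by (auto simp: cycle_sign_def circ_def)
  moreover have "sigma_inv P c = (i0, j0)" using sigma_inv_eq[OF c] p(5) by simp
  ultimately show thesis using that p by metis
qed

lemma cycle_sign_rows:
  "c \<in> simple_cycles P \<Longrightarrow> i \<in> classes P \<Longrightarrow> (\<Sum>j\<in>stations P. cycle_sign P c i j) = 0"
  by (erule cycle_sign_eq_circ) (simp add: circ_rows)

lemma cycle_sign_cols:
  "c \<in> simple_cycles P \<Longrightarrow> j \<in> stations P \<Longrightarrow> (\<Sum>i\<in>classes P. cycle_sign P c i j) = 0"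
  by (erule cycle_sign_eq_circ) (simp add: circ_cols)

lemma cycle_sign_off_cycle:
  "c \<in> simple_cycles P \<Longrightarrow> i \<in> classes P \<Longrightarrow> j \<in> stations P \<Longrightarrow> (i, j) \<notin> c \<Longrightarrow> cycle_sign P c i j = 0"
  by (erule cycle_sign_eq_circ) (auto simp: circ_off_cycle)

lemma cycle_sign_nonbasic:
  assumes c: "c \<in> simple_cycles P" and e: "sigma_inv P c = (i, j)"
  shows "cycle_sign P c i j = - 1"
proof (rule cycle_sign_eq_circ[OF c])
  fix p assume "undirected_cycle (act_graph P (acts P)) p" "sigma_inv P c \<in> set p"
    "\<And>i j. cycle_sign P c i j = circ p i j"
  then show ?thesis using e undirected_cycle_no_reverse_arc[of _ p i j] by (auto simp: circ_def)
qed

lemma m_cycle_eq: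
  assumes "c \<in> simple_cycles P" "i \<in> classes P"
  shows "m_cycle P n c i = (\<Sum>j\<in>stations P. cycle_sign P c i j * mu_n P n i j)"
  unfolding m_cycle_def using assms cycle_sign_off_cycle by (intro sum.mono_neutral_left) auto

text \<open>The array \<open>g\<close> reroutes every nonbasic entry of \<open>psi\<close> along its simple cycle to the basic
  activities. Rerouting preserves all row and column sums, so \<open>g\<close> is \<open>G_map P a b\<close>.\<close>

lemma H_map_eq:
  assumes rows: "\<And>i. i \<in> classes P \<Longrightarrow> (\<Sum>j\<in>stations P. psi i j) = a i"
    and cols: "\<And>j. j \<in> stations P \<Longrightarrow> (\<Sum>i\<in>classes P. psi i j) = b j"
    and supp: "\<And>i j. i \<in> classes P \<Longrightarrow> j \<in> stations P \<Longrightarrow> (i, j) \<notin> acts P \<Longrightarrow> psi i j = 0"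
    and i: "i \<in> classes P"
  shows "H_map P n a b i = - (\<Sum>j\<in>stations P. mu_n P n i j * psi i j)
           - (\<Sum>c\<in>simple_cycles P. m_cycle P n c i * case_prod psi (sigma_inv P c))"
proof -
  define w where "w c = case_prod psi (sigma_inv P c)" for c
  define g where "g i j = psi i j + (\<Sum>c\<in>simple_cycles P. cycle_sign P c i j * w c)" for i j
  have "G_map P a b i j = g i j" if j: "j \<in> stations P" for j
  proof (rule G_map_eq[OF _ _ _ i j])
    show "(\<Sum>j\<in>stations P. g i j) = a i" if "i \<in> classes P" for i
    proof -
      have "(\<Sum>j\<in>stations P. \<Sum>c\<in>simple_cycles P. cycle_sign P c i j * w c) =
            (\<Sum>c\<in>simple_cycles P. (\<Sum>j\<in>stations P. cycle_sign P c i j) * w c)"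
        by (subst sum.swap) (simp add: sum_distrib_right)
      then show ?thesis using that by (simp add: g_def sum.distrib rows cycle_sign_rows)
    qed
    show "(\<Sum>i\<in>classes P. g i j) = b j" if "j \<in> stations P" for j
    proof -
      have "(\<Sum>i\<in>classes P. \<Sum>c\<in>simple_cycles P. cycle_sign P c i j * w c) =
            (\<Sum>c\<in>simple_cycles P. (\<Sum>i\<in>classes P. cycle_sign P c i j) * w c)"
        by (subst sum.swap) (simp add: sum_distrib_right)
      then show ?thesis using that by (simp add: g_def sum.distrib cols cycle_sign_cols)
    qed
    show "g k l = 0" if kl: "k \<in> classes P" "l \<in> stations P" "(k, l) \<notin> basic_acts P" for k l
    proof (cases "(k, l) \<in> acts P")
      case False
      then have "cycle_sign P c k l = 0" if "c \<in> simple_cycles P" for c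
        using that kl by (intro cycle_sign_off_cycle) (auto simp: simple_cycles_def cycle_edges_def)
      then show ?thesis using False kl supp by (simp add: g_def)
    next
      case True
      with kl have nb: "(k, l) \<in> nonbasic_acts P" by (simp add: nonbasic_acts_def)
      then obtain c where c: "c \<in> simple_cycles P" "(k, l) \<in> c"
        and uniq: "\<And>d. d \<in> simple_cycles P \<Longrightarrow> (k, l) \<in> d \<Longrightarrow> d = c"
        using simple_cycle_through_unique by metis
      have "(k, l) \<in> {sigma_inv P c}" using sigma_inv_eq[OF c(1)] c nb by blast
      then have e: "sigma_inv P c = (k, l)" by simp
      \<comment> \<open>Only the simple cycle through \<open>(k, l)\<close> contributes, and its sign there is \<open>- 1\<close>.\<close>
      have "(\<Sum>d\<in>simple_cycles P. cycle_sign P d k l * w d) =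
            (\<Sum>d\<in>{c}. cycle_sign P d k l * w d)"
      proof (intro sum.mono_neutral_right finite_simple_cycles ballI)
        show "{c} \<subseteq> simple_cycles P" using c by simp
        fix d assume "d \<in> simple_cycles P - {c}"
        then show "cycle_sign P d k l * w d = 0"
          using cycle_sign_off_cycle[of d k l] uniq[of d] kl by auto
      qed
      also have "\<dots> = - psi k l" using cycle_sign_nonbasic[OF c(1) e] e by (simp add: w_def)
      finally show ?thesis by (simp add: g_def)
    qed
  qed
  then have "H_map P n a b i = - (\<Sum>j\<in>stations P. mu_n P n i j * g i j)"
    by (simp add: H_map_def)
  also have "\<dots> = - (\<Sum>j\<in>stations P. mu_n P n i j * psi i j)
      - (\<Sum>j\<in>stations P. \<Sum>c\<in>simple_cycles P. cycle_sign P c i j * mu_n P n i j * w c)"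
    by (simp add: g_def distrib_left sum.distrib sum_distrib_left mult_ac)
  also have "(\<Sum>j\<in>stations P. \<Sum>c\<in>simple_cycles P. cycle_sign P c i j * mu_n P n i j * w c)
      = (\<Sum>c\<in>simple_cycles P. m_cycle P n c i * w c)"
    using i by (subst sum.swap) (simp add: m_cycle_eq sum_distrib_right)
  finally show ?thesis by (simp add: w_def)
qed

end

section \<open>Occupancy along a sample path\<close>

lemma set_integral_linear_combination:
  fixes f :: "'b \<Rightarrow> 'a \<Rightarrow> real"
  assumes "finite A" "\<And>a. a \<in> A \<Longrightarrow> set_integrable M T (f a)"
  shows "set_integrable M T (\<lambda>s. \<Sum>a\<in>A. c a * f a s)"
    and "(LINT s:T|M. (\<Sum>a\<in>A. c a * f a s)) = (\<Sum>a\<in>A. c a * (LINT s:T|M. f a s))"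
proof -
  have "indicator T s *\<^sub>R (\<Sum>a\<in>A. c a * f a s) = (\<Sum>a\<in>A. c a * (indicator T s *\<^sub>R f a s))" for s
    by (simp add: sum_distrib_left mult_ac)
  then show "set_integrable M T (\<lambda>s. \<Sum>a\<in>A. c a * f a s)"
    and "(LINT s:T|M. (\<Sum>a\<in>A. c a * f a s)) = (\<Sum>a\<in>A. c a * (LINT s:T|M. f a s))"
    using assms unfolding set_integrable_def set_lebesgue_integral_def
    by (simp_all only: Bochner_Integration.integral_sum integrable_mult_right
          integral_mult_right_zero Bochner_Integration.integrable_sum)
qed

lemma set_integrable_const_Icc: "set_integrable lborel {a..b :: real} (\<lambda>_. c :: real)"
  by (rule borel_integrable_compact[unfolded set_integrable_def[symmetric]]) auto

text \<open>Interarrival times are strictly positive, so no customer arrives at time 0. This is needed to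
  identify \<open>X 0\<close> with \<open>X0\<close>.\<close>

lemma arrivals_0:
  assumes lam: "0 < lam_n P n i" and U: "\<And>k. 1 \<le> k \<Longrightarrow> 0 < U i k \<omega>"
  shows "arrivals P n U i 0 \<omega> = 0"
proof -
  have "0 < (\<Sum>k=1..l. U i k \<omega> / lam_n P n i)" if "l \<noteq> 0" for l
    using that lam U by (intro sum_pos) auto
  then have "{l. (\<Sum>k=1..l. U i k \<omega> / lam_n P n i) \<le> 0} = {0}"
    by (force simp: not_less[symmetric])
  then show ?thesis by (simp add: arrivals_def)
qed

text \<open>The centred occupancy is the array to which \<open>H_map_eq\<close> is applied: its row and column sums
  are the arguments of \<open>H_map\<close>, since the row sums of \<open>psi_star\<close> are \<open>x_star\<close> and its
  column sums are \<open>nu\<close>.\<close>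

definition Psi_hat ::
  "network \<Rightarrow> nat \<Rightarrow> (nat \<Rightarrow> nat \<Rightarrow> real \<Rightarrow> 'w \<Rightarrow> int) \<Rightarrow> nat \<Rightarrow> nat \<Rightarrow> real \<Rightarrow> 'w \<Rightarrow> real" where
  "Psi_hat P n Psi i j t \<omega> = (real_of_int (Psi i j t \<omega>) - real n * psi_star P i j) / sqrt (real n)"

context
  fixes P :: network and n :: nat
    and U :: "nat \<Rightarrow> nat \<Rightarrow> 'w \<Rightarrow> real"
    and S :: "nat \<Rightarrow> nat \<Rightarrow> real \<Rightarrow> 'w \<Rightarrow> nat"
    and X0 :: "nat \<Rightarrow> nat"
    and X Y Z :: "nat \<Rightarrow> real \<Rightarrow> 'w \<Rightarrow> int"
    and Psi :: "nat \<Rightarrow> nat \<Rightarrow> real \<Rightarrow> 'w \<Rightarrow> int"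
    and \<omega> :: 'w
  assumes network: "heavy_traffic_network P" and n: "1 \<le> n"
    and model: "model_equations P n U S X0 X Y Z Psi \<omega>"
begin

interpretation heavy_traffic_network P by (rule network)

lemma classes_stations_nonempty: "classes P \<noteq> {}" "stations P \<noteq> {}"
  using two_classes two_stations by (auto simp: classes_def stations_def)

lemma model_station:
  assumes "0 \<le> t" "j \<in> stations P"
  shows "Z j t \<omega> + (\<Sum>i\<in>classes P. Psi i j t \<omega>) = int (N_n P n j)" "0 \<le> Z j t \<omega>"
  using model assms classes_stations_nonempty(1) unfolding model_equations_def by blast+

lemma model_class:
  assumes "0 \<le> t" "i \<in> classes P"
  shows "X i t \<omega> = int (X0 i) + int (arrivals P n U i t \<omega>)
           - (\<Sum>j\<in>stations P. int (S i j (LINT s:{0..t}|lborel. real_of_int (Psi i j s \<omega>)) \<omega>))"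
    and "Y i t \<omega> + (\<Sum>j\<in>stations P. Psi i j t \<omega>) = X i t \<omega>" and "0 \<le> Y i t \<omega>"
  using model assms classes_stations_nonempty(2) unfolding model_equations_def by blast+

lemma model_activity:
  assumes "0 \<le> t" "i \<in> classes P" "j \<in> stations P"
  shows "0 \<le> Psi i j t \<omega>" and "(i, j) \<notin> acts P \<Longrightarrow> Psi i j t \<omega> = 0"
  using model assms unfolding model_equations_def by blast+

text \<open>The occupancy is bounded by the number of servers of its station.\<close>

lemma Psi_set_integrable:
  assumes ij: "i \<in> classes P" "j \<in> stations P"
  shows "set_integrable lborel {0..t} (\<lambda>s. real_of_int (Psi i j s \<omega>))"
proof (rule set_integrable_bound)
  show "set_integrable lborel {0..t} (\<lambda>_. real (N_n P n j))"
    by (rule set_integrable_const_Icc)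
  have "set_borel_measurable lborel {0..} (\<lambda>s. real_of_int (Psi i j s \<omega>))"
    using model ij unfolding model_equations_def by blast
  then show "set_borel_measurable lborel {0..t} (\<lambda>s. real_of_int (Psi i j s \<omega>))"
    by (rule set_borel_measurable_subset) auto
  have "norm (real_of_int (Psi i j s \<omega>)) \<le> norm (real (N_n P n j))" if "0 \<le> s" for s
  proof -
    have "Psi i j s \<omega> \<le> (\<Sum>i\<in>classes P. Psi i j s \<omega>)"
      using ij model_activity(1)[OF that] by (intro member_le_sum) auto
    then have "Psi i j s \<omega> \<le> int (N_n P n j)" using model_station[OF that ij(2)] by linarith
    then show ?thesis using model_activity(1)[OF that ij] by simp
  qed
  then show "AE s in lborel. s \<in> {0..t} \<longrightarrow>
      norm (real_of_int (Psi i j s \<omega>)) \<le> norm (real (N_n P n j))"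
    by auto
qed

lemma Psi_hat_rows:
  assumes "0 \<le> t" "i \<in> classes P"
  shows "(\<Sum>j\<in>stations P. Psi_hat P n Psi i j t \<omega>) = X_hat P n X i t \<omega> - Y_hat n Y i t \<omega>"
  using model_class(2)[OF assms, symmetric]
  by (simp add: Psi_hat_def X_hat_def Y_hat_def x_star_def psi_star_def
      sum_divide_distrib[symmetric] sum_subtractf sum_distrib_left[symmetric] diff_divide_distrib add_divide_distrib)

lemma Psi_hat_cols:
  assumes "0 \<le> t" "j \<in> stations P"
  shows "(\<Sum>i\<in>classes P. Psi_hat P n Psi i j t \<omega>) = N_hat P n j - Z_hat n Z j t \<omega>"
proof -
  have "real (N_n P n j) = real_of_int (Z j t \<omega> + (\<Sum>i\<in>classes P. Psi i j t \<omega>))"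
    using model_station(1)[OF assms] by simp
  then have "(\<Sum>i\<in>classes P. Psi_hat P n Psi i j t \<omega>) =
      (real (N_n P n j) - real n * nu P j - real_of_int (Z j t \<omega>)) / sqrt (real n)"
    using assms(2)
    by (simp add: Psi_hat_def sum_divide_distrib[symmetric] sum_subtractf
        sum_distrib_left[symmetric] sum_psi_star_station)
  also have "\<dots> = N_hat P n j - Z_hat n Z j t \<omega>"
    using n by (simp add: N_hat_def Z_hat_def field_simps)
  finally show ?thesis .
qed

lemma Psi_hat_off_acts:
  assumes "0 \<le> t" "i \<in> classes P" "j \<in> stations P" "(i, j) \<notin> acts P"
  shows "Psi_hat P n Psi i j t \<omega> = 0"
  using assms model_activity(2) psi_star_zero_off_basic[of i j] basic_subset by (auto simp: Psi_hat_def)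

lemma sigma_invE:
  assumes "c \<in> simple_cycles P"
  obtains i j where "sigma_inv P c = (i, j)" "i \<in> classes P" "j \<in> stations P" "psi_star P i j = 0"
proof -
  obtain i j where e: "sigma_inv P c = (i, j)" by (cases "sigma_inv P c")
  have "sigma_inv P c \<in> nonbasic_acts P" using sigma_inv_eq[OF assms] by blast
  then have "i \<in> classes P" "j \<in> stations P" "(i, j) \<notin> basic_acts P"
    unfolding e using acts_subset by (auto simp: nonbasic_acts_def)
  with e show thesis using that psi_star_zero_off_basic by blast
qed

text \<open>On a nonbasic activity the centring \<open>psi_star\<close> is zero, so centred and uncentred scalings agree.\<close>

lemma Psi_cycle_hat_eq:
  assumes "c \<in> simple_cycles P"
  shows "(case sigma_inv P c of (i, j) \<Rightarrow> Psi_hat P n Psi i j t \<omega>) = Psi_cycle_hat P n Psi c t \<omega>"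
  by (rule sigma_invE[OF assms]) (simp add: Psi_hat_def Psi_cycle_hat_def)

lemma H_map_path:
  assumes "0 \<le> s" "i \<in> classes P"
  shows "H_map P n (\<lambda>k. X_hat P n X k s \<omega> - Y_hat n Y k s \<omega>) (\<lambda>j. N_hat P n j - Z_hat n Z j s \<omega>) i =
    - (\<Sum>j\<in>stations P. mu_n P n i j * Psi_hat P n Psi i j s \<omega>)
    - (\<Sum>c\<in>simple_cycles P. m_cycle P n c i * Psi_cycle_hat P n Psi c s \<omega>)"
  using assms
  by (subst H_map_eq[where psi = "\<lambda>i j. Psi_hat P n Psi i j s \<omega>"])
     (simp_all add: Psi_hat_rows Psi_hat_cols Psi_hat_off_acts Psi_cycle_hat_eq)

lemma Psi_hat_integral:
  assumes "0 \<le> t" "i \<in> classes P" "j \<in> stations P"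
  shows "set_integrable lborel {0..t} (\<lambda>s. Psi_hat P n Psi i j s \<omega>)"
    and "(LINT s:{0..t}|lborel. Psi_hat P n Psi i j s \<omega>) =
      ((LINT s:{0..t}|lborel. real_of_int (Psi i j s \<omega>)) - real n * psi_star P i j * t) / sqrt (real n)"
proof -
  have const: "set_integrable lborel {0..t} (\<lambda>_. real n * psi_star P i j)"
    by (rule set_integrable_const_Icc)
  note diff = set_integral_diff[OF Psi_set_integrable[OF assms(2,3)] const]
  show "set_integrable lborel {0..t} (\<lambda>s. Psi_hat P n Psi i j s \<omega>)"
    unfolding Psi_hat_def using diff(1) by (simp add: set_integrable_def)
  show "(LINT s:{0..t}|lborel. Psi_hat P n Psi i j s \<omega>) =
      ((LINT s:{0..t}|lborel. real_of_int (Psi i j s \<omega>)) - real n * psi_star P i j * t) / sqrt (real n)"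
    using assms(1) diff(2) by (simp add: Psi_hat_def set_integral_const)
qed

lemma Psi_cycle_hat_integrable:
  assumes "0 \<le> t" "c \<in> simple_cycles P"
  shows "set_integrable lborel {0..t} (\<lambda>s. Psi_cycle_hat P n Psi c s \<omega>)"
proof (rule sigma_invE[OF assms(2)])
  fix i j assume "sigma_inv P c = (i, j)" "i \<in> classes P" "j \<in> stations P"
  then show ?thesis
    using Psi_hat_integral(1)[OF assms(1), of i j] by (simp add: Psi_cycle_hat_eq[OF assms(2), symmetric])
qed

lemma H_map_integral:
  assumes t: "0 \<le> t" and i: "i \<in> classes P"
  shows "(LINT s:{0..t}|lborel.
      H_map P n (\<lambda>k. X_hat P n X k s \<omega> - Y_hat n Y k s \<omega>) (\<lambda>j. N_hat P n j - Z_hat n Z j s \<omega>) i) =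
    - (\<Sum>j\<in>stations P. mu_n P n i j * (LINT s:{0..t}|lborel. Psi_hat P n Psi i j s \<omega>))
    - (\<Sum>c\<in>simple_cycles P. m_cycle P n c i * (LINT s:{0..t}|lborel. Psi_cycle_hat P n Psi c s \<omega>))"
proof -
  let ?f = "\<lambda>s. \<Sum>j\<in>stations P. - mu_n P n i j * Psi_hat P n Psi i j s \<omega>"
  let ?g = "\<lambda>s. \<Sum>c\<in>simple_cycles P. m_cycle P n c i * Psi_cycle_hat P n Psi c s \<omega>"
  note f = set_integral_linear_combination[OF finite_stations Psi_hat_integral(1)[OF t i],
      where c = "\<lambda>j. - mu_n P n i j", of P]
  note g = set_integral_linear_combination[OF finite_simple_cycles Psi_cycle_hat_integrable[OF t],
      where c = "\<lambda>c. m_cycle P n c i"]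
  have "(LINT s:{0..t}|lborel.
      H_map P n (\<lambda>k. X_hat P n X k s \<omega> - Y_hat n Y k s \<omega>) (\<lambda>j. N_hat P n j - Z_hat n Z j s \<omega>) i) =
    (LINT s:{0..t}|lborel. ?f s - ?g s)"
    using i by (intro set_lebesgue_integral_cong) (auto simp: H_map_path sum_negf)
  also have "\<dots> = (LINT s:{0..t}|lborel. ?f s) - (LINT s:{0..t}|lborel. ?g s)"
    by (rule set_integral_diff(2)[OF f(1) g(1)]) auto
  finally show ?thesis by (simp only: f(2) g(2)) (simp add: sum_negf)
qed

text \<open>The fluid limits cancel by the balance \<open>lam_eq\<close> of the static allocation; only the rates of the
  \<open>n\<close>-th system remain.\<close>

lemma drift_balance:
  assumes "i \<in> classes P"
  shows "lam_n P n i / sqrt (real n) - ell P n i =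
    sqrt (real n) * (\<Sum>j\<in>stations P. mu_n P n i j * psi_star P i j)"
proof -
  have "(\<Sum>j\<in>stations P. mu_hat P n i j * psi_star P i j) =
      sqrt (real n) * (\<Sum>j\<in>stations P. mu_n P n i j * psi_star P i j) - sqrt (real n) * lam P i"
    using assms by (simp add: lam_eq mu_hat_def left_diff_distrib right_diff_distrib sum_subtractf
        sum_distrib_left mult_ac)
  moreover have "sqrt (real n) * (lam_n P n i / real n) = lam_n P n i / sqrt (real n)"
    using n by (simp add: field_simps)
  ultimately show ?thesis by (simp add: ell_def lam_hat_def right_diff_distrib)
qed

text \<open>The scaled balance equation before \<open>Psi_hat\<close> is decomposed along simple cycles: the sum is the
  effect of service at rates \<open>mu_n\<close> by the deviation from the static allocation.\<close>

lemma X_hat_path: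
  assumes t: "0 \<le> t" and i: "i \<in> classes P"
    and start: "X i 0 \<omega> = int (X0 i)"
  shows "X_hat P n X i t \<omega> = X_hat P n X i 0 \<omega> + W_hat P n U S Psi i t \<omega>
    + (\<Sum>j\<in>stations P. - (mu_n P n i j * (LINT s:{0..t}|lborel. Psi_hat P n Psi i j s \<omega>)))"
proof -
  define r where "r = sqrt (real n)"
  have r: "0 < r" "real n = r * r" using n by (auto simp: r_def)
  define I where "I j = (LINT s:{0..t}|lborel. real_of_int (Psi i j s \<omega>))" for j
  define D where "D j = real (S i j (I j) \<omega>)" for j
  define m where "m = mu_n P n i"
  define q where "q = psi_star P i"
  have drift: "lam_n P n i / r - ell P n i = r * (\<Sum>j\<in>stations P. m j * q j)"
    using drift_balance[OF i] unfolding r_def m_def q_def .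
  have S: "S_hat P n S i j (LINT s:{0..t}|lborel. Psi_bar n Psi i j s \<omega>) \<omega> = (D j - m j * I j) / r" for j
    using n by (simp add: S_hat_def Psi_bar_def D_def m_def I_def r_def)
  have Q: "(LINT s:{0..t}|lborel. Psi_hat P n Psi i j s \<omega>) = (I j - real n * q j * t) / r" if "j \<in> stations P" for j
    using Psi_hat_integral(2)[OF t i that] unfolding r_def[symmetric] I_def q_def .
  have "X_hat P n X i t \<omega> - X_hat P n X i 0 \<omega> = (real (arrivals P n U i t \<omega>) - (\<Sum>j\<in>stations P. D j)) / r"
    unfolding X_hat_def model_class(1)[OF t i] start
    by (simp add: D_def I_def r_def diff_divide_distrib add_divide_distrib)
  also have "\<dots> = W_hat P n U S Psi i t \<omega> + (lam_n P n i / r - ell P n i) * t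
      - (\<Sum>j\<in>stations P. m j * I j / r)"
    unfolding W_hat_def A_hat_def S r_def[symmetric]
    by (simp add: diff_divide_distrib sum_subtractf sum_divide_distrib algebra_simps)
  also have "\<dots> = W_hat P n U S Psi i t \<omega> + (\<Sum>j\<in>stations P. - (m j * ((I j - real n * q j * t) / r)))"
    using r by (simp add: drift sum_distrib_left sum_distrib_right sum_subtractf sum_negf
        diff_divide_distrib right_diff_distrib mult_ac)
  finally show ?thesis by (simp add: Q m_def)
qed

end

theorem theorem2p1:
  fixes P :: network and n :: nat and M :: "'w measure"
    and U :: "nat \<Rightarrow> nat \<Rightarrow> 'w \<Rightarrow> real"
    and S :: "nat \<Rightarrow> nat \<Rightarrow> real \<Rightarrow> 'w \<Rightarrow> nat"
    and X0 :: "nat \<Rightarrow> nat"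
    and X Y Z :: "nat \<Rightarrow> real \<Rightarrow> 'w \<Rightarrow> int"
    and Psi :: "nat \<Rightarrow> nat \<Rightarrow> real \<Rightarrow> 'w \<Rightarrow> int"
    and \<omega> :: 'w
  assumes "heavy_traffic_network P"
    and "1 \<le> n"
    and "primitive_processes M P n U S"
    and "counting_processes M P X Y Z Psi"
    and "\<omega> \<in> space M"
    and "model_equations P n U S X0 X Y Z Psi \<omega>"
  shows "\<forall>t\<ge>0.
     (\<forall>i\<in>classes P.
        X_hat P n X i t \<omega> =
          X_hat P n X i 0 \<omega> + W_hat P n U S Psi i t \<omega>
          + (LINT s:{0..t}|lborel.
               H_map P n (\<lambda>k. X_hat P n X k s \<omega> - Y_hat n Y k s \<omega>)
                         (\<lambda>j. N_hat P n j - Z_hat n Z j s \<omega>) i)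
          + (\<Sum>c\<in>simple_cycles P.
               m_cycle P n c i * (LINT s:{0..t}|lborel. Psi_cycle_hat P n Psi c s \<omega>))) \<and>
     (\<forall>i\<in>classes P. 0 \<le> Y_hat n Y i t \<omega>) \<and>
     (\<forall>j\<in>stations P. 0 \<le> Z_hat n Z j t \<omega>) \<and>
     (\<Sum>i\<in>classes P. X_hat P n X i t \<omega> - Y_hat n Y i t \<omega>) =
       (\<Sum>j\<in>stations P. N_hat P n j - Z_hat n Z j t \<omega>) \<and>
     (\<forall>c\<in>simple_cycles P. 0 \<le> Psi_cycle_hat P n Psi c t \<omega>)"
proof (intro allI impI conjI ballI)
  interpret heavy_traffic_network P by fact
  interpret primitive_processes M P n U S by fact
  note path = assms(1,2,6)
  fix t :: real assume t: "0 \<le> t"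
  show "X_hat P n X i t \<omega> =
      X_hat P n X i 0 \<omega> + W_hat P n U S Psi i t \<omega>
      + (LINT s:{0..t}|lborel.
           H_map P n (\<lambda>k. X_hat P n X k s \<omega> - Y_hat n Y k s \<omega>)
                     (\<lambda>j. N_hat P n j - Z_hat n Z j s \<omega>) i)
      + (\<Sum>c\<in>simple_cycles P.
           m_cycle P n c i * (LINT s:{0..t}|lborel. Psi_cycle_hat P n Psi c s \<omega>))"
    if i: "i \<in> classes P" for i
  proof -
    have "arrivals P n U i 0 \<omega> = 0"
      using lam_n_pos[OF \<open>1 \<le> n\<close> i] U_pos[OF i _ \<open>\<omega> \<in> space M\<close>] by (rule arrivals_0)
    moreover have "S i j 0 \<omega> = 0" if j: "j \<in> stations P" for j
    proof (cases "mu_n P n i j = 0")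
      case True
      then show ?thesis using S_zero[OF i j] \<open>\<omega> \<in> space M\<close> by simp
    next
      case False
      then have "0 < mu_n P n i j" using mu_n_nonneg[OF \<open>1 \<le> n\<close> i j] by simp
      then show ?thesis using S_poisson[OF i j] \<open>\<omega> \<in> space M\<close> by (simp add: poisson_process_def)
    qed
    moreover have "(LINT s:{0..0::real}|lborel. real_of_int (Psi i j s \<omega>)) = 0" for j
      unfolding set_lebesgue_integral_def
      by (rule integral_eq_zero_AE) (use AE_lborel_singleton[of "0::real"] in eventually_elim, simp)
    ultimately have "X i 0 \<omega> = int (X0 i)"
      using model_class(1)[OF path order.refl i] by simp
    then show ?thesis
      using X_hat_path[OF path t i] H_map_integral[OF path t i] by (simp add: sum_negf)
  qed
  show "0 \<le> Y_hat n Y i t \<omega>" if "i \<in> classes P" for i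
    using model_class(3)[OF path t that] by (simp add: Y_hat_def)
  show "0 \<le> Z_hat n Z j t \<omega>" if "j \<in> stations P" for j
    using model_station(2)[OF path t that] by (simp add: Z_hat_def)
  show "(\<Sum>i\<in>classes P. X_hat P n X i t \<omega> - Y_hat n Y i t \<omega>) =
      (\<Sum>j\<in>stations P. N_hat P n j - Z_hat n Z j t \<omega>)"
    by (simp add: Psi_hat_rows[OF path t, symmetric] Psi_hat_cols[OF path t, symmetric]) (rule sum.swap)
  show "0 \<le> Psi_cycle_hat P n Psi c t \<omega>" if c: "c \<in> simple_cycles P" for c
  proof (rule sigma_invE[OF path c])
    fix i j assume "sigma_inv P c = (i, j)" "i \<in> classes P" "j \<in> stations P"
    then show ?thesis using model_activity(1)[OF path t] by (simp add: Psi_cycle_hat_def)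
  qed
qed

end
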